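(* Let $\alpha_i,\beta_i,\gamma_i\in\mathbb{C}$ ($i=0,1,2$) with $(\gamma_1,\gamma_2)\neq(0,0)$ be such that $$f(x_1,x_2)=\left(\alpha_0+\alpha_1x_1+\alpha_2x_2,\ \frac{\beta_0+\beta_1x_1+\beta_2x_2}{\gamma_0+\gamma_1x_1+\gamma_2x_2}\right)$$ is birational, and suppose $\beta_1\gamma_2-\beta_2\gamma_1=0$ and $\gamma_1=0$. Let $d_n=\deg(F^n)$, where $F$ is the extension of $f$ to $\mathbb{P}^2(\mathbb{C})$. (i) Assume $\alpha_2\neq0$. Then, after an affine change of coordinates (and renaming the parameters), $f$ can be written as $$f(x,y)=\left(\alpha_0+\alpha_1x+y,\ \frac{\beta_0}{\gamma_0+y}\right),\qquad \alpha_1\neq0\neq\beta_0,$$ and, with $h(y):=\frac{\beta_0}{\gamma_0+y}$, the following hold: (a) If the one-dimensional mapping $h$ is not a periodic map, then the sequence of degrees is $d_n=1+n$. (b) If $h$ is a $k$-periodic map and $1+\alpha_1^k+\alpha_1^{2k}+\cdots+\alpha_1^{nk}\neq0$ for all $n\in\mathbb{N}$, then $d_n=1+n$ for all $n\le k-1$ and $d_n=k$ for all $n\ge k$. (c) If $h$ is a $k$-periodic map and $1+\alpha_1^k+\alpha_1^{2k}+\cdots+\alpha_1^{nk}=0$ for some $n\in\mathbb{N}$, then, for this $n$, the sequence of degrees is an $(n+1)k$-periodic sequence. (ii) Assume $\alpha_2=0$. Then, after an affine change of coordinates (and renaming the parameters), $f$ can be written as $$f(x,y)=\left(\alpha_0+\alpha_1x,\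 \frac{\beta_0}{\gamma_0+y}\right),\qquad \alpha_1\neq0\neq\beta_0,$$ and, with $h(y):=\frac{\beta_0}{\gamma_0+y}$, the following hold: (a) If the one-dimensional mapping $h$ is not a periodic map, then $d_n=2$ for all $n\in\mathbb{N}$. (b) If $h$ is a $k$-periodic map, then $d_n$ is a $k$-periodic sequence.
   Context: A map $f:\mathbb{C}^2\to\mathbb{C}^2$ with rational components is birational if there exist an algebraic curve $V$ and a rational map $g$ with $f\circ g=g\circ f=\mathrm{id}$ on $\mathbb{C}^2\setminus V$. Via the embedding $(x_1,x_2)\mapsto[1:x_1:x_2]$, $f$ induces a map $F:\mathbb{P}^2(\mathbb{C})\to\mathbb{P}^2(\mathbb{C})$ with homogeneous polynomial components; $d_n=\deg(F^n)$ is the common degree of the components of the iterate $F^n=F\circ\cdots\circ F$ after removing common factors ($n\ge1$). A one-dimensional Möbius map $h$ is $k$-periodic if $h^k=\mathrm{id}$ ($h^k$ the $k$-th iterate) with $k\ge1$ minimal; it is periodic if it is $k$-periodic for some $k$. *)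

theory Defs
  imports Complex_Main "HOL-Computational_Algebra.Computational_Algebra"
    "HOL-Computational_Algebra.Field_as_Ring"
begin

section \<open>Polynomials in two and three variables\<close>

text \<open>
  A \<open>bipoly\<close> is an element of $\mathbb{C}[x_1][x_2]$, and a \<open>terpoly\<close> is an element of
  $\mathbb{C}[x_1][x_2][x_0]$: the outermost variable of a \<open>terpoly\<close> is the homogenizing
  variable $x_0$. So \<open>coeff (coeff p j) i\<close> is the coefficient of $x_1^i x_2^j$ in a \<open>bipoly\<close>,
  and \<open>coeff (coeff (coeff P k) j) i\<close> is that of $x_0^k x_1^i x_2^j$ in a \<open>terpoly\<close>.
\<close>

type_synonym bipoly = "complex poly poly"
type_synonym terpoly = "complex poly poly poly"

definition eval2 :: "bipoly \<Rightarrow> complex \<times> complex \<Rightarrow> complex" where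
  "eval2 p = (\<lambda>(x1, x2). poly (poly p [:x2:]) x1)"

definition eval3 :: "terpoly \<Rightarrow> complex \<times> complex \<times> complex \<Rightarrow> complex" where
  "eval3 P = (\<lambda>(x0, x1, x2). eval2 (poly P [:[:x0:]:]) (x1, x2))"

definition tdeg2 :: "bipoly \<Rightarrow> nat" where
  "tdeg2 p = Max (insert 0 {i + j | i j. coeff (coeff p j) i \<noteq> 0})"

definition tdeg3 :: "terpoly \<Rightarrow> nat" where
  "tdeg3 P = Max (insert 0 {k + i + j | k i j. coeff (coeff (coeff P k) j) i \<noteq> 0})"

text \<open>
  The homogenization $x_0^m\, p(x_1/x_0, x_2/x_0)$ in degree $m$; it is only used for
  \<open>m \<ge> tdeg2 p\<close>, so the subtraction below does not truncate at nonzero coefficients.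
\<close>

definition homogenize :: "nat \<Rightarrow> bipoly \<Rightarrow> terpoly" where
  "homogenize m p = (\<Sum>j\<le>degree p. \<Sum>i\<le>degree (coeff p j).
     monom (monom (monom (coeff (coeff p j) i) i) j) (m - i - j))"

text \<open>The polynomial $P(A, B, C)$, i.e. $x_0, x_1, x_2$ are replaced by $A, B, C$.\<close>

definition subst3 :: "terpoly \<Rightarrow> terpoly \<times> terpoly \<times> terpoly \<Rightarrow> terpoly" where
  "subst3 P = (\<lambda>(A, B, C). \<Sum>k\<le>degree P. \<Sum>j\<le>degree (coeff P k).
     \<Sum>i\<le>degree (coeff (coeff P k) j).
       [:[:[:coeff (coeff (coeff P k) j) i:]:]:] * A ^ k * B ^ i * C ^ j)"


lemma eval2_altdef:
  "eval2 p (x1, x2) = (\<Sum>j\<le>degree p. \<Sum>i\<le>degree (coeff p j). coeff (coeff p j) i * x1 ^ i * x2 ^ j)"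
  by (simp add: eval2_def poly_altdef[of p] poly_sum poly_power poly_altdef[of "coeff _ _"] sum_distrib_right)

lemma eval2_hom [simp]:
  "eval2 (p + q) x = eval2 p x + eval2 q x" "eval2 (p * q) x = eval2 p x * eval2 q x"
  "eval2 0 x = 0" "eval2 1 x = 1" "eval2 [:[:c:]:] x = c"
  by (simp_all add: eval2_def split: prod.splits)

lemma eval2_more [simp]: "eval2 (p ^ n) x = eval2 p x ^ n" "eval2 (sum g A) x = (\<Sum>a\<in>A. eval2 (g a) x)"
  by (induction n, simp_all) (induction A rule: infinite_finite_induct, simp_all)

lemma eval3_hom [simp]:
  "eval3 (p + q) x = eval3 p x + eval3 q x" "eval3 (p * q) x = eval3 p x * eval3 q x"
  "eval3 0 x = 0" "eval3 1 x = 1" "eval3 [:[:[:c:]:]:] x = c"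
  by (simp_all add: eval3_def split: prod.splits)

lemma eval3_more [simp]: "eval3 (p ^ n) x = eval3 p x ^ n" "eval3 (sum g A) x = (\<Sum>a\<in>A. eval3 (g a) x)"
  by (induction n, simp_all) (induction A rule: infinite_finite_induct, simp_all)

lemma eval3_altdef:
  "eval3 P (x0, x1, x2) = (\<Sum>k\<le>degree P. \<Sum>j\<le>degree (coeff P k). \<Sum>i\<le>degree (coeff (coeff P k) j).
     coeff (coeff (coeff P k) j) i * x0 ^ k * x1 ^ i * x2 ^ j)"
  by (simp add: eval3_def poly_altdef[of P] eval2_altdef[of "coeff _ _"] sum_distrib_left sum_distrib_right mult_ac)

lemma eval3_subst3:
  "eval3 (subst3 P (A, B, C)) v = eval3 P (eval3 A v, eval3 B v, eval3 C v)"
  by (simp add: subst3_def eval3_altdef mult_ac del: mult_pCons_left mult_pCons_right)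

lemma eval3_homogenize: "eval3 (homogenize m p) (1, x) = eval2 p x"
proof -
  obtain x1 x2 where x: "x = (x1, x2)" by force
  have "eval3 (monom (monom (monom c i) j) k) (1, x1, x2) = c * x1 ^ i * x2 ^ j" for c i j k
    by (simp add: eval3_def eval2_def poly_monom poly_power flip: one_pCons)
  then show ?thesis by (simp add: x homogenize_def eval2_altdef)
qed


section \<open>Rational maps of the plane\<close>

text \<open>
  A rational function is given by a numerator and a denominator, and it is regarded as defined
  where that denominator does not vanish.
\<close>

type_synonym ratfun = "bipoly \<times> bipoly"
type_synonym ratmap = "ratfun \<times> ratfun"

definition rational_map :: "ratmap \<Rightarrow> bool" where
  "rational_map f \<longleftrightarrow> snd (fst f) \<noteq> 0 \<and> snd (snd f) \<noteq> 0"

definition defined_at :: "ratmap \<Rightarrow> complex \<times> complex \<Rightarrow> bool" where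
  "defined_at f x \<longleftrightarrow> eval2 (snd (fst f)) x \<noteq> 0 \<and> eval2 (snd (snd f)) x \<noteq> 0"

definition apply_map :: "ratmap \<Rightarrow> complex \<times> complex \<Rightarrow> complex \<times> complex" where
  "apply_map f x =
     (eval2 (fst (fst f)) x / eval2 (snd (fst f)) x, eval2 (fst (snd f)) x / eval2 (snd (snd f)) x)"

definition algebraic_curve :: "(complex \<times> complex) set \<Rightarrow> bool" where
  "algebraic_curve V \<longleftrightarrow> (\<exists>p. tdeg2 p > 0 \<and> V = {x. eval2 p x = 0})"

definition birational :: "ratmap \<Rightarrow> bool" where
  "birational f \<longleftrightarrow> rational_map f \<and>
     (\<exists>V g. algebraic_curve V \<and> rational_map g \<and>
       (\<forall>x. x \<notin> V \<longrightarrow>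
          defined_at g x \<and> defined_at f (apply_map g x) \<and> apply_map f (apply_map g x) = x \<and>
          defined_at f x \<and> defined_at g (apply_map f x) \<and> apply_map g (apply_map f x) = x))"

text \<open>The affine linear polynomial $c_0 + c_1 x_1 + c_2 x_2$.\<close>

definition affine_poly :: "complex \<Rightarrow> complex \<Rightarrow> complex \<Rightarrow> bipoly" where
  "affine_poly c0 c1 c2 = [:[:c0, c1:], [:c2:]:]"

definition fractional_map ::
  "complex \<times> complex \<times> complex \<Rightarrow> complex \<times> complex \<times> complex \<Rightarrow> complex \<times> complex \<times> complex \<Rightarrow> ratmap"
where
  "fractional_map = (\<lambda>(a0, a1, a2) (b0, b1, b2) (c0, c1, c2).
     ((affine_poly a0 a1 a2, 1), (affine_poly b0 b1 b2, affine_poly c0 c1 c2)))"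

definition affine_change :: "(complex \<times> complex \<Rightarrow> complex \<times> complex) \<Rightarrow> bool" where
  "affine_change \<phi> \<longleftrightarrow> (\<exists>a b c d s t. a * d - b * c \<noteq> 0 \<and>
     \<phi> = (\<lambda>(x, y). (a * x + b * y + s, c * x + d * y + t)))"

text \<open>
  $\varphi \circ f = f' \circ \varphi$ as rational maps, that is, at every point where both sides
  are defined. For rational maps this is a dense set.
\<close>

definition conjugate_by ::
  "(complex \<times> complex \<Rightarrow> complex \<times> complex) \<Rightarrow> ratmap \<Rightarrow> ratmap \<Rightarrow> bool" where
  "conjugate_by \<phi> f f' \<longleftrightarrow> (\<forall>x. defined_at f x \<and> defined_at f' (\<phi> x) \<longrightarrow>
     \<phi> (apply_map f x) = apply_map f' (\<phi> x))"


section \<open>Extension to the projective plane and degrees of the iterates\<close>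

text \<open>
  For $f = (p_1/q_1, p_2/q_2)$ the extension is
  $F = [q_1 q_2 : p_1 q_2 : p_2 q_1]$, homogenized in a common degree. Common factors, if any,
  are only removed when degrees are taken.
\<close>

definition proj_extension :: "ratmap \<Rightarrow> terpoly \<times> terpoly \<times> terpoly" where
  "proj_extension = (\<lambda>((p1, q1), (p2, q2)).
     (let m = Max {tdeg2 (q1 * q2), tdeg2 (p1 * q2), tdeg2 (p2 * q1)}
      in (homogenize m (q1 * q2), homogenize m (p1 * q2), homogenize m (p2 * q1))))"

lemma proj_extension_induces:
  assumes "defined_at f x" "proj_extension f = (F0, F1, F2)"
  shows "eval3 F0 (1, x) \<noteq> 0"
    and "apply_map f x = (eval3 F1 (1, x) / eval3 F0 (1, x), eval3 F2 (1, x) / eval3 F0 (1, x))"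
  using assms
  by (auto simp: proj_extension_def defined_at_def apply_map_def Let_def eval3_homogenize
      split: prod.splits)

definition proj_comp ::
  "terpoly \<times> terpoly \<times> terpoly \<Rightarrow> terpoly \<times> terpoly \<times> terpoly \<Rightarrow> terpoly \<times> terpoly \<times> terpoly" where
  "proj_comp F G = (subst3 (fst F) G, subst3 (fst (snd F)) G, subst3 (snd (snd F)) G)"

text \<open>The starting value of the iteration is the identity $[x_0 : x_1 : x_2]$.\<close>

definition proj_iterate ::
  "nat \<Rightarrow> terpoly \<times> terpoly \<times> terpoly \<Rightarrow> terpoly \<times> terpoly \<times> terpoly" where
  "proj_iterate n F = (proj_comp F ^^ n) ([:0, 1:], [:[:[:0, 1:]:]:], [:[:0, 1:]:])"

text \<open>
  For homogeneous components of equal degree the nonzero ones still have equal degree after the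
  division by their greatest common divisor; the maximum only discounts zero components.
\<close>

definition reduced_degree :: "terpoly \<times> terpoly \<times> terpoly \<Rightarrow> nat" where
  "reduced_degree = (\<lambda>(P0, P1, P2).
     (let g = gcd P0 (gcd P1 P2) in Max {tdeg3 (P0 div g), tdeg3 (P1 div g), tdeg3 (P2 div g)}))"

definition iterate_degree :: "ratmap \<Rightarrow> nat \<Rightarrow> nat" where
  "iterate_degree f n = reduced_degree (proj_iterate n (proj_extension f))"


section \<open>Periodicity\<close>

text \<open>
  One-dimensional Moebius maps act on the Riemann sphere, modelled as \<open>complex option\<close> with
  \<open>None\<close> as the point at infinity. This is the map $z \mapsto (a z + b)/(c z + d)$.
\<close>

definition moebius ::
  "complex \<Rightarrow> complex \<Rightarrow> complex \<Rightarrow> complex \<Rightarrow> complex option \<Rightarrow> complex option" where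
  "moebius a b c d z = (case z of
       None \<Rightarrow> if c = 0 then None else Some (a / c)
     | Some y \<Rightarrow> if c * y + d = 0 then None else Some ((a * y + b) / (c * y + d)))"

definition periodic_map_of :: "nat \<Rightarrow> ('a \<Rightarrow> 'a) \<Rightarrow> bool" where
  "periodic_map_of k h \<longleftrightarrow> k \<ge> 1 \<and> h ^^ k = id \<and> (\<forall>j. 1 \<le> j \<and> j < k \<longrightarrow> h ^^ j \<noteq> id)"

definition periodic_map :: "('a \<Rightarrow> 'a) \<Rightarrow> bool" where
  "periodic_map h \<longleftrightarrow> (\<exists>k. periodic_map_of k h)"

text \<open>Sequences are indexed by the integers $n \ge 1$.\<close>

definition seq_period :: "nat \<Rightarrow> (nat \<Rightarrow> 'a) \<Rightarrow> bool" where
  "seq_period p d \<longleftrightarrow> p \<ge> 1 \<and> (\<forall>n\<ge>1. d (n + p) = d n)"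

definition periodic_seq_of :: "nat \<Rightarrow> (nat \<Rightarrow> 'a) \<Rightarrow> bool" where
  "periodic_seq_of p d \<longleftrightarrow> seq_period p d \<and> (\<forall>q<p. \<not> seq_period q d)"

end

theory Submission
  imports Defs
begin

text \<open>
  Since $\gamma_1 = \beta_1 = 0$, the second component of $f$ is a Moebius map $h$ of $x_2$ alone, and
  the first one is affine. The iterates can therefore be written down: the second component of $f^n$ is
  $y_n = h^n(x_2)$, and the first one is
  \[ x_n = \alpha_1^n x_1 + c_n + \alpha_2 \sum_{j<n} \alpha_1^{n-1-j} y_j \]
  with a constant $c_n$. Each $y_j$ has a single simple pole, at $h^{-j}(\infty)$, which as a line in
  the projective plane is given by a linear form $L_j$ in $x_0$ and $x_2$; here $L_0 = x_0$ is the line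
  at infinity, along which $\alpha_1^n x_1$ has its pole. Clearing denominators in this partial
  fraction decomposition with the product of the distinct polar lines gives coprime homogeneous
  components, so \<^emph>\<open>the degree $d_n$ is the number of polar lines of $f^n$\<close>
  (lemma \<open>iterate_degree_eq_card_poles\<close>). The polar lines are $L_0$, $L_n$ and those $L_j$ whose total
  coefficient in $x_n$ does not vanish.
  
  What remains is to count. The powers of the matrix of $h$ are governed by its Lucas sequence $u$:
  both the proportionality of $L_i$ and $L_{i+m}$ and the identity $h^m = \mathrm{id}$ are equivalent
  to $u_m = 0$. In particular the pole of $h$ returns to itself only if $h$ is periodic. If $h$ is not
  periodic, the lines $L_0, \ldots, L_n$ are distinct, which gives $d_n = 1 + n$ for
  $\alpha_2 \neq 0$ and $d_n = 2$ for $\alpha_2 = 0$. If $h$ is $k$-periodic, $L_j$ depends only on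
  $j$ modulo $k$, and the coefficient that $y_r$ ($r < k$) accumulates in $x_n$ is a power of $\alpha_1$ times
  $1 + \alpha_1^k + \cdots + \alpha_1^{qk}$, where $q + 1$ is the number of $j < n$ with
  $j \equiv r$ modulo $k$ (lemma \<open>weight_after\<close>). If none of these sums vanishes, all $k$ lines are
  polar from $n = k$ on. If the first one to vanish is that with $q = m$, all poles but the line at
  infinity cancel at $n = (m+1)k$, whence $d_n = 1$ there for the first time and the coefficients start anew.
  
  Finally, a conjugation of $f$ to the normal form is necessarily triangular, so that it preserves
  $\alpha_1$ and the period of $h$ (lemma \<open>conjugation_invariants\<close>); for this reason the degrees of $f$ can be
  described by the parameters of any normal form.
\<close>

section \<open>Homogeneous polynomials and reduced degrees\<close>

definition homogeneous :: "nat \<Rightarrow> terpoly \<Rightarrow> bool" where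
  "homogeneous m P \<longleftrightarrow> (\<forall>k j i. coeff (coeff (coeff P k) j) i \<noteq> 0 \<longrightarrow> k + i + j = m)"

lemma homogeneous_add:
  assumes "homogeneous m P" "homogeneous m Q"
  shows "homogeneous m (P + Q)"
  unfolding homogeneous_def
proof (intro allI impI)
  fix k j i assume "coeff (coeff (coeff (P + Q) k) j) i \<noteq> 0"
  then have "coeff (coeff (coeff P k) j) i \<noteq> 0 \<or> coeff (coeff (coeff Q k) j) i \<noteq> 0"
    by auto
  then show "k + i + j = m" using assms unfolding homogeneous_def by blast
qed

lemma homogeneous_mult:
  assumes P: "homogeneous m P" and Q: "homogeneous n Q"
  shows "homogeneous (m + n) (P * Q)"
  unfolding homogeneous_def
proof (intro allI impI)
  fix k j i assume "coeff (coeff (coeff (P * Q) k) j) i \<noteq> 0"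
  then have "(\<Sum>a\<le>k. \<Sum>b\<le>j. \<Sum>c\<le>i. coeff (coeff (coeff P a) b) c *
      coeff (coeff (coeff Q (k - a)) (j - b)) (i - c)) \<noteq> 0"
    by (simp add: coeff_mult coeff_sum)
  then obtain a where "a \<le> k" "(\<Sum>b\<le>j. \<Sum>c\<le>i. coeff (coeff (coeff P a) b) c *
      coeff (coeff (coeff Q (k - a)) (j - b)) (i - c)) \<noteq> 0"
    by (metis (no_types, lifting) atMost_iff sum.not_neutral_contains_not_neutral)
  moreover from this obtain b where "b \<le> j" "(\<Sum>c\<le>i. coeff (coeff (coeff P a) b) c *
      coeff (coeff (coeff Q (k - a)) (j - b)) (i - c)) \<noteq> 0"
    by (metis (no_types, lifting) atMost_iff sum.not_neutral_contains_not_neutral)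
  moreover from this obtain c where "c \<le> i" "coeff (coeff (coeff P a) b) c *
      coeff (coeff (coeff Q (k - a)) (j - b)) (i - c) \<noteq> 0"
    by (metis (no_types, lifting) atMost_iff sum.not_neutral_contains_not_neutral)
  ultimately have *: "a \<le> k" "b \<le> j" "c \<le> i" "coeff (coeff (coeff P a) b) c \<noteq> 0"
      "coeff (coeff (coeff Q (k - a)) (j - b)) (i - c) \<noteq> 0"
    by auto
  from *(4) P have "a + c + b = m" unfolding homogeneous_def by blast
  moreover from *(5) Q have "k - a + (i - c) + (j - b) = n" unfolding homogeneous_def by blast
  ultimately show "k + i + j = m + n" using *(1-3) by linarith
qed

lemma homogeneous_0 [simp]: "homogeneous m 0"
  by (simp add: homogeneous_def)

lemma homogeneous_sum:
  "(\<And>a. a \<in> A \<Longrightarrow> homogeneous m (P a)) \<Longrightarrow> homogeneous m (sum P A)"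
  by (induction A rule: infinite_finite_induct) (auto intro: homogeneous_add)

lemma homogeneous_const [simp]: "homogeneous 0 [:[:[:c:]:]:]"
  by (auto simp: homogeneous_def coeff_pCons split: nat.splits)

lemma homogeneous_prod:
  "(\<And>a. a \<in> A \<Longrightarrow> homogeneous 1 (P a)) \<Longrightarrow> homogeneous (card A) (prod P A)"
proof (induction A rule: infinite_finite_induct)
  case (insert a A)
  then show ?case using homogeneous_mult[of 1 "P a" "card A" "prod P A"] by simp
qed (use homogeneous_const[of 1] in \<open>auto simp: one_pCons simp del: homogeneous_const\<close>)

lemma homogeneous_unit:
  assumes "is_unit (u :: terpoly)"
  shows "homogeneous 0 u"
proof -
  obtain p where p: "u = [:p:]" "is_unit p" using assms by (auto simp: is_unit_poly_iff)
  obtain q where q: "p = [:q:]" "is_unit q" using p(2) by (auto simp: is_unit_poly_iff)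
  obtain c where c: "q = [:c:]" using q(2) by (auto simp: is_unit_poly_iff)
  show ?thesis by (simp add: p q c)
qed

lemma tdeg3_homogeneous:
  assumes "homogeneous m P"
  shows "tdeg3 P = (if P = 0 then 0 else m)"
proof (cases "P = 0")
  case True
  then show ?thesis by (simp add: tdeg3_def)
next
  case False
  then obtain k j i where "coeff (coeff (coeff P k) j) i \<noteq> 0"
    by (metis leading_coeff_0_iff)
  then have "{k + i + j | k i j. coeff (coeff (coeff P k) j) i \<noteq> 0} = {m}"
    using assms unfolding homogeneous_def by blast
  then show ?thesis using False by (simp add: tdeg3_def)
qed

text \<open>
  The degree of a map $[P_0 : P_1 : P_2]$ can be read off any coprime triple $(R_0, R_1, R_2)$ of
  forms of equal degree that is proportional to it. Indeed $R_0 \cdot \gcd(P_0,P_1,P_2)$ and $P_0$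
  are both a greatest common divisor of $R_0P_0, R_0P_1, R_0P_2$, so dividing the $P_i$ by their
  common factor gives the $R_i$ up to a unit, that is, up to a nonzero constant. This avoids ever
  computing the common factor of an iterate.
\<close>

lemma reduced_degree_eq:
  assumes hom: "homogeneous m R0" "homogeneous m R1" "homogeneous m R2"
    and coprime: "\<And>p. prime p \<Longrightarrow> p dvd R0 \<Longrightarrow> p dvd R1 \<Longrightarrow> p dvd R2 \<Longrightarrow> False"
    and nz: "R0 \<noteq> 0" "P0 \<noteq> 0"
    and eq: "P1 * R0 = P0 * R1" "P2 * R0 = P0 * R2"
  shows "reduced_degree (P0, P1, P2) = m"
proof -
  define g where "g = gcd P0 (gcd P1 P2)"
  have g0: "g \<noteq> 0" using nz by (simp add: g_def)
  have "is_unit (gcd R0 (gcd R1 R2))"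
  proof (rule ccontr)
    assume "\<not> is_unit (gcd R0 (gcd R1 R2))"
    then obtain p where "prime p" "p dvd gcd R0 (gcd R1 R2)"
      using nz prime_divisor_exists[of "gcd R0 (gcd R1 R2)"] by auto
    then show False using coprime[of p] by simp
  qed
  then have gcd_R: "gcd R0 (gcd R1 R2) = 1" by (metis is_unit_gcd_iff)
  have factor_out: "gcd (a * b) (gcd (a * c) (a * d)) = normalize (a * gcd b (gcd c d))"
    for a b c d :: terpoly
  proof -
    have "gcd (a * c) (a * d) = normalize (a * gcd c d)"
      by (simp add: gcd_mult_left normalize_mult)
    then have "gcd (a * b) (gcd (a * c) (a * d)) = gcd (a * b) (a * gcd c d)" by simp
    then show ?thesis by (simp add: gcd_mult_left normalize_mult)
  qed
  have "normalize (R0 * g) = gcd (R0 * P0) (gcd (R0 * P1) (R0 * P2))"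
    by (simp only: g_def factor_out)
  also have "\<dots> = gcd (P0 * R0) (gcd (P0 * R1) (P0 * R2))"
    using eq by (simp add: mult.commute)
  also have "\<dots> = normalize (P0 * gcd R0 (gcd R1 R2))"
    by (rule factor_out)
  finally have "normalize (R0 * g) = normalize P0" by (simp add: gcd_R)
  then obtain u where u: "is_unit u" "P0 = u * (R0 * g)"
    by (metis associatedE1)
  have "R0 * P1 = R0 * (u * (R1 * g))" "R0 * P2 = R0 * (u * (R2 * g))"
    using eq u(2) by (simp_all add: mult_ac)
  then have P: "P1 = u * (R1 * g)" "P2 = u * (R2 * g)" using nz by simp_all
  have "P0 div g = u * R0" "P1 div g = u * R1" "P2 div g = u * R2"
    by (simp_all add: u(2) P g0 flip: mult.assoc)
  moreover have "homogeneous m (u * R0)" "homogeneous m (u * R1)" "homogeneous m (u * R2)"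
    using homogeneous_mult[OF homogeneous_unit[OF u(1)]] hom by force+
  moreover have "u * R0 \<noteq> 0" using u nz by auto
  ultimately show ?thesis
    by (simp add: reduced_degree_def Let_def tdeg3_homogeneous flip: g_def)
qed

section \<open>The extension of the map to the projective plane\<close>

definition X0 :: terpoly where "X0 = [:0, 1:]"
definition X1 :: terpoly where "X1 = [:[:[:0, 1:]:]:]"
definition X2 :: terpoly where "X2 = [:[:0, 1:]:]"

definition scalar :: "complex \<Rightarrow> terpoly" where "scalar c = [:[:[:c:]:]:]"

lemma scalar_hom:
  "scalar 0 = 0" "scalar 1 = 1" "scalar (a + b) = scalar a + scalar b"
  "scalar (a - b) = scalar a - scalar b" "scalar (- a) = - scalar a"
  "scalar (a * b) = scalar a * scalar b"
  by (simp_all add: scalar_def one_pCons)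

lemma scalar_eq_0_iff [simp]: "scalar c = 0 \<longleftrightarrow> c = 0"
  by (simp add: scalar_def)

lemma homogeneous_scalar [simp]: "homogeneous 0 (scalar c)"
  by (auto simp: homogeneous_def scalar_def coeff_pCons split: nat.splits)

lemma homogeneous_X [simp]: "homogeneous 1 X0" "homogeneous 1 X1" "homogeneous 1 X2"
  by (auto simp: homogeneous_def X0_def X1_def X2_def coeff_pCons one_pCons split: nat.splits if_splits)

lemma is_unit_scalar: "c \<noteq> 0 \<Longrightarrow> is_unit (scalar c)"
  by (simp add: scalar_def is_unit_poly_iff dvd_field_iff)

text \<open>
  A polynomial \<open>[:q:]\<close> does not involve $x_0$, so its divisors do not either; the only such divisors
  of $x_0$ are units.
\<close>

lemma is_unit_if_dvd_X0:
  assumes "p dvd X0" "p dvd [:q:]" "q \<noteq> 0"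
  shows "is_unit p"
proof -
  have "degree p \<le> degree [:q:]" using assms by (intro dvd_imp_degree_le) auto
  then obtain r where r: "p = [:r:]" by (auto elim: degree_eq_zeroE)
  have "r dvd 1" using assms(1) unfolding r X0_def const_poly_dvd_iff
    by (metis coeff_pCons_Suc coeff_pCons_0)
  then show ?thesis by (simp add: r is_unit_poly_iff)
qed

lemma scalar_combination_eq_0_iff:
  "scalar a * X2 + scalar b * X0 = 0 \<longleftrightarrow> a = 0 \<and> b = 0"
  by (simp add: scalar_def X0_def X2_def)

lemma poly_map_poly:
  fixes \<phi> :: "'a :: zero \<Rightarrow> 'b :: comm_semiring_1"
  assumes "\<phi> 0 = 0"
  shows "poly (map_poly \<phi> p) x = (\<Sum>i\<le>degree p. \<phi> (coeff p i) * x ^ i)"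
proof -
  have "i \<le> degree (map_poly \<phi> p)" if "\<phi> (coeff p i) * x ^ i \<noteq> 0" for i
    using that by (intro le_degree) (auto simp: coeff_map_poly assms)
  then show ?thesis
    unfolding poly_altdef
    by (intro sum.mono_neutral_cong_left) (auto simp: coeff_map_poly assms map_poly_degree_leq)
qed

text \<open>
  Horner-style evaluation, one variable at a time. Unlike the defining triple sum, whose range depends
  on the degrees of the coefficients and hence on which parameters vanish, it computes on explicit
  polynomials with symbolic coefficients.
\<close>

lemma subst3_conv_poly:
  "subst3 P (A, B, C) =
     poly (map_poly (\<lambda>q. poly (map_poly (\<lambda>r. poly (map_poly scalar r) B) q) C) P) A"
  unfolding subst3_def
  by (simp add: poly_map_poly scalar_hom sum_distrib_left sum_distrib_right mult_ac flip: scalar_def)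

text \<open>
  The components of the map are polynomials of degree at most 2, and all of these have the shape below.
  The coefficients may be zero, so a single computation covers all degenerate parameter values.
\<close>

lemma homogenize_quadratic:
  "homogenize 2 [:[:a, b, c:], [:d, e:], [:g:]:] =
     [:[:[:0, 0, c:], [:0, e:], [:g:]:], [:[:0, b:], [:d:]:], [:[:a:]:]:]"
  (is "homogenize 2 ?p = _")
proof -
  have "homogenize 2 ?p =
    (\<Sum>j\<le>2. \<Sum>i\<le>2. monom (monom (monom (coeff (coeff ?p j) i) i) j) (2 - i - j))"
    unfolding homogenize_def
  proof (rule sum.mono_neutral_cong_left)
    fix j assume "j \<in> {..degree ?p}"
    show "(\<Sum>i\<le>degree (coeff ?p j). monom (monom (monom (coeff (coeff ?p j) i) i) j) (2 - i - j)) =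
      (\<Sum>i\<le>2. monom (monom (monom (coeff (coeff ?p j) i) i) j) (2 - i - j))"
      by (rule sum.mono_neutral_left) (auto simp: coeff_eq_0 coeff_pCons split: nat.splits)
  qed (auto simp: coeff_eq_0)
  also have "\<dots> = [:[:[:0, 0, c:], [:0, e:], [:g:]:], [:[:0, b:], [:d:]:], [:[:a:]:]:]"
    by (simp add: numeral_2_eq_2 monom_Suc monom_0)
  finally show ?thesis .
qed

lemma tdeg2_quadratic:
  "tdeg2 [:[:a, b, c:], [:d, e:], [:g:]:] \<le> 2"
  "e \<noteq> 0 \<Longrightarrow> tdeg2 [:[:a, b, c:], [:d, e:], [:g:]:] = 2"
proof -
  let ?S = "{i + j |i j. coeff (coeff [:[:a, b, c:], [:d, e:], [:g:]:] j) i \<noteq> 0}"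
  have "i + j \<le> 2" if "coeff (coeff [:[:a, b, c:], [:d, e:], [:g:]:] j) i \<noteq> 0" for i j
    using that by (auto simp: coeff_pCons split: nat.splits)
  then have sub: "?S \<subseteq> {..2}" by blast
  then have fin: "finite (insert 0 ?S)" using finite_subset by blast
  show le: "tdeg2 [:[:a, b, c:], [:d, e:], [:g:]:] \<le> 2"
    unfolding tdeg2_def using sub fin by (subst Max_le_iff) auto
  assume "e \<noteq> 0"
  then have "coeff (coeff [:[:a, b, c:], [:d, e:], [:g:]:] 1) 1 \<noteq> 0" by simp
  then have "\<exists>i j. 2 = i + j \<and> coeff (coeff [:[:a, b, c:], [:d, e:], [:g:]:] j) i \<noteq> 0"
    by (intro exI[of _ 1] conjI) simp_all
  then have "2 \<le> Max (insert 0 ?S)" using fin by (intro Max_ge) blast+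
  then show "tdeg2 [:[:a, b, c:], [:d, e:], [:g:]:] = 2"
    using le unfolding tdeg2_def by simp
qed

text \<open>
  The common degree of the extension is exactly 2: the numerator
  $(\alpha_0+\alpha_1x_1+\alpha_2x_2)(\gamma_0+\gamma_2x_2)$ contributes the monomial $x_1x_2$ with
  coefficient $\alpha_1\gamma_2 \neq 0$.
\<close>

lemma proj_extension_fractional_map:
  fixes \<alpha>\<^sub>0 \<alpha>\<^sub>1 \<alpha>\<^sub>2 \<beta>\<^sub>0 \<beta>\<^sub>2 \<gamma>\<^sub>0 \<gamma>\<^sub>2 :: complex
  assumes "\<alpha>\<^sub>1 \<noteq> 0" "\<gamma>\<^sub>2 \<noteq> 0"
  shows "proj_comp (proj_extension (fractional_map (\<alpha>\<^sub>0, \<alpha>\<^sub>1, \<alpha>\<^sub>2) (\<beta>\<^sub>0, 0, \<beta>\<^sub>2) (\<gamma>\<^sub>0, 0, \<gamma>\<^sub>2))) (P0, P1, P2) =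
     (P0 * (scalar \<gamma>\<^sub>0 * P0 + scalar \<gamma>\<^sub>2 * P2),
      (scalar \<alpha>\<^sub>0 * P0 + scalar \<alpha>\<^sub>1 * P1 + scalar \<alpha>\<^sub>2 * P2) * (scalar \<gamma>\<^sub>0 * P0 + scalar \<gamma>\<^sub>2 * P2),
      P0 * (scalar \<beta>\<^sub>0 * P0 + scalar \<beta>\<^sub>2 * P2))"
proof -
  let ?Q0 = "[:[:\<gamma>\<^sub>0, 0, 0:], [:\<gamma>\<^sub>2, 0:], [:0:]:]"
  let ?Q1 = "[:[:\<alpha>\<^sub>0 * \<gamma>\<^sub>0, \<alpha>\<^sub>1 * \<gamma>\<^sub>0, 0:], [:\<alpha>\<^sub>0 * \<gamma>\<^sub>2 + \<alpha>\<^sub>2 * \<gamma>\<^sub>0, \<alpha>\<^sub>1 * \<gamma>\<^sub>2:], [:\<alpha>\<^sub>2 * \<gamma>\<^sub>2:]:]"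
  let ?Q2 = "[:[:\<beta>\<^sub>0, 0, 0:], [:\<beta>\<^sub>2, 0:], [:0:]:]"
  have Q: "1 * affine_poly \<gamma>\<^sub>0 0 \<gamma>\<^sub>2 = ?Q0"
     "affine_poly \<alpha>\<^sub>0 \<alpha>\<^sub>1 \<alpha>\<^sub>2 * affine_poly \<gamma>\<^sub>0 0 \<gamma>\<^sub>2 = ?Q1"
     "affine_poly \<beta>\<^sub>0 0 \<beta>\<^sub>2 * 1 = ?Q2"
    by (simp_all add: affine_poly_def mult.commute)
  have "Max {tdeg2 ?Q0, tdeg2 ?Q1, tdeg2 ?Q2} = 2"
    using assms tdeg2_quadratic(1)[of \<gamma>\<^sub>0 0 0 \<gamma>\<^sub>2 0 0] tdeg2_quadratic(1)[of \<beta>\<^sub>0 0 0 \<beta>\<^sub>2 0 0]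
    by (subst tdeg2_quadratic(2)) auto
  then have "proj_extension (fractional_map (\<alpha>\<^sub>0, \<alpha>\<^sub>1, \<alpha>\<^sub>2) (\<beta>\<^sub>0, 0, \<beta>\<^sub>2) (\<gamma>\<^sub>0, 0, \<gamma>\<^sub>2)) =
      (homogenize 2 ?Q0, homogenize 2 ?Q1, homogenize 2 ?Q2)"
    unfolding proj_extension_def fractional_map_def split Let_def Q by simp
  then show ?thesis
    unfolding homogenize_quadratic proj_comp_def fst_conv snd_conv subst3_conv_poly
    by (simp add: map_poly_pCons scalar_hom algebra_simps)
qed

section \<open>Lucas sequences and periodic Moebius maps\<close>

text \<open>
  The Lucas sequence of trace $T$ and determinant $D$. By the theorem of Cayley and Hamilton a
  $2 \times 2$ matrix $M$ with this trace and determinant has the powers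
  $M^n = u_n M + (u_{n+1} - T u_n) I$; so, for $M$ not scalar, $M^n$ is scalar exactly if $u_n = 0$.
\<close>

fun lucas :: "complex \<Rightarrow> complex \<Rightarrow> nat \<Rightarrow> complex" where
  "lucas T D 0 = 0"
| "lucas T D (Suc 0) = 1"
| "lucas T D (Suc (Suc n)) = T * lucas T D (Suc n) - D * lucas T D n"

text \<open>
  This is $\det M^n = D^n$. It makes two consecutive terms nonzero together with $D$: they never vanish
  simultaneously.
\<close>

lemma lucas_norm:
  "lucas T D (Suc n) ^ 2 - T * lucas T D n * lucas T D (Suc n) + D * lucas T D n ^ 2 = D ^ n"
proof (induction n)
  case (Suc n)
  have "lucas T D (Suc (Suc n)) ^ 2 - T * lucas T D (Suc n) * lucas T D (Suc (Suc n))
      + D * lucas T D (Suc n) ^ 2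
    = D * (lucas T D (Suc n) ^ 2 - T * lucas T D n * lucas T D (Suc n) + D * lucas T D n ^ 2)"
    by (simp add: algebra_simps power2_eq_square)
  then show ?case by (simp only: Suc.IH power_Suc)
qed simp

text \<open>
  Multiplying a matrix by $s$ does not change its Moebius map, and it does not change the zeros of its
  Lucas sequence.
\<close>

lemma lucas_scale: "s * lucas (s * T) (s ^ 2 * D) n = s ^ n * lucas T D n"
proof (induction n rule: induct_nat_012)
  case (ge2 n)
  have "s * lucas (s * T) (s ^ 2 * D) (Suc (Suc n)) =
      s * T * (s * lucas (s * T) (s ^ 2 * D) (Suc n)) - s ^ 2 * D * (s * lucas (s * T) (s ^ 2 * D) n)"
    by (simp add: algebra_simps)
  also have "\<dots> = s ^ Suc (Suc n) * lucas T D (Suc (Suc n))"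
    unfolding ge2 by (simp add: algebra_simps power2_eq_square)
  finally show ?case .
qed simp_all

text \<open>
  The point of the sphere with homogeneous coordinates $[p : q]$. In these coordinates a Moebius map is
  linear, which spares the case distinctions at the pole and at infinity when maps are composed.
\<close>

definition sphere_point :: "complex \<Rightarrow> complex \<Rightarrow> complex option" where
  "sphere_point p q = (if q = 0 then None else Some (p / q))"

lemma moebius_sphere_point:
  assumes "p \<noteq> 0 \<or> q \<noteq> 0"
  shows "moebius a b c d (sphere_point p q) = sphere_point (a * p + b * q) (c * p + d * q)"
proof (cases "q = 0")
  case True
  then show ?thesis using assms by (simp add: moebius_def sphere_point_def)
next
  case False
  then have c: "c * (p / q) + d = (c * p + d * q) / q" and a: "a * (p / q) + b = (a * p + b * q) / q"
    by (simp_all add: add_divide_distrib)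
  have scale: "(if v / q = 0 then None else Some (u / q / (v / q))) = sphere_point u v" for u v
    using False by (simp add: sphere_point_def)
  have "moebius a b c d (sphere_point p q) = (if c * (p / q) + d = 0 then None
      else Some ((a * (p / q) + b) / (c * (p / q) + d)))"
    using False by (simp add: moebius_def sphere_point_def)
  also have "\<dots> = sphere_point (a * p + b * q) (c * p + d * q)"
    unfolding c a by (rule scale)
  finally show ?thesis .
qed

lemma moebius_comp:
  assumes "a' * d' - b' * c' \<noteq> 0"
  shows "moebius a b c d (moebius a' b' c' d' z) =
    moebius (a * a' + b * c') (a * b' + b * d') (c * a' + d * c') (c * b' + d * d') z"
proof -
  obtain p q where z: "z = sphere_point p q" "p \<noteq> 0 \<or> q \<noteq> 0"
  proof (cases z)
    case None
    then show ?thesis using that[of 1 0] by (simp add: sphere_point_def)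
  next
    case (Some y)
    then show ?thesis using that[of y 1] by (simp add: sphere_point_def)
  qed
  have "a' * p + b' * q \<noteq> 0 \<or> c' * p + d' * q \<noteq> 0"
  proof (rule ccontr)
    assume "\<not> ?thesis"
    moreover have "(a' * d' - b' * c') * p = d' * (a' * p + b' * q) - b' * (c' * p + d' * q)"
      "(a' * d' - b' * c') * q = a' * (c' * p + d' * q) - c' * (a' * p + b' * q)"
      by algebra+
    ultimately show False using assms z(2) by simp
  qed
  then show ?thesis
    using z(2) by (simp add: z(1) moebius_sphere_point algebra_simps)
qed

lemma moebius_eq_id_iff:
  assumes "a * d - b * c \<noteq> 0"
  shows "moebius a b c d = id \<longleftrightarrow> b = 0 \<and> c = 0 \<and> a = d"
proof
  assume id: "moebius a b c d = id"
  have c: "c = 0" using fun_cong[OF id, of None] by (auto simp: moebius_def split: if_splits)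
  have d: "d \<noteq> 0" using assms c by auto
  have b: "b = 0" using fun_cong[OF id, of "Some 0"] c d by (auto simp: moebius_def)
  have "a = d" using fun_cong[OF id, of "Some 1"] c d b by (auto simp: moebius_def)
  then show "b = 0 \<and> c = 0 \<and> a = d" using b c by simp
next
  assume "b = 0 \<and> c = 0 \<and> a = d"
  then show "moebius a b c d = id" using assms
    by (auto simp: moebius_def fun_eq_iff split: option.splits)
qed

lemma moebius_funpow:
  fixes b c :: complex
  assumes "b \<noteq> 0"
  defines "u \<equiv> lucas c (- b)"
  shows "moebius 0 b 1 c ^^ n = moebius (u (Suc n) - c * u n) (b * u n) (u n) (u (Suc n))"
proof (induction n)
  case 0
  show ?case using moebius_eq_id_iff[of 1 1 0 0] by (simp add: u_def)
next
  case (Suc n)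
  have det: "(u (Suc n) - c * u n) * u (Suc n) - b * u n * u n \<noteq> 0"
    using lucas_norm[of c "- b" n] assms
    by (simp add: u_def algebra_simps power2_eq_square)
  have rec: "u (Suc (Suc n)) = c * u (Suc n) + b * u n" by (simp add: u_def)
  show ?case
  proof
    fix z
    have "(moebius 0 b 1 c ^^ Suc n) z = moebius 0 b 1 c (moebius (u (Suc n) - c * u n) (b * u n) (u n) (u (Suc n)) z)"
      by (simp add: Suc.IH)
    also have "\<dots> = moebius (0 * (u (Suc n) - c * u n) + b * u n) (0 * (b * u n) + b * u (Suc n))
       (1 * (u (Suc n) - c * u n) + c * u n) (1 * (b * u n) + c * u (Suc n)) z"
      using det by (intro moebius_comp)
    also have "\<dots> = moebius (u (Suc (Suc n)) - c * u (Suc n)) (b * u (Suc n)) (u (Suc n)) (u (Suc (Suc n))) z"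
      unfolding rec by (simp add: algebra_simps)
    finally show "(moebius 0 b 1 c ^^ Suc n) z = \<dots>" .
  qed
qed

lemma moebius_funpow_eq_id_iff:
  assumes "b \<noteq> 0"
  shows "moebius 0 b 1 c ^^ n = id \<longleftrightarrow> lucas c (- b) n = 0"
proof -
  define u v where "u = lucas c (- b) n" and "v = lucas c (- b) (Suc n)"
  have "(v - c * u) * v - b * u * u = v ^ 2 - c * u * v + (- b) * u ^ 2"
    by (simp add: algebra_simps power2_eq_square)
  also have "\<dots> \<noteq> 0"
    unfolding u_def v_def lucas_norm using assms by simp
  finally have "moebius (v - c * u) (b * u) u v = id \<longleftrightarrow> b * u = 0 \<and> u = 0 \<and> v - c * u = v"
    by (rule moebius_eq_id_iff)
  then show ?thesis
    unfolding moebius_funpow[OF assms] u_def v_def using assms by auto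
qed

lemma periodic_map_least:
  assumes "n \<ge> 1" "h ^^ n = id"
  shows "periodic_map h"
proof -
  define k where "k = (LEAST k. k \<ge> 1 \<and> h ^^ k = id)"
  have "k \<ge> 1 \<and> h ^^ k = id" unfolding k_def by (rule LeastI) (use assms in auto)
  moreover have "h ^^ j \<noteq> id" if "1 \<le> j" "j < k" for j
    using that not_less_Least unfolding k_def by blast
  ultimately show ?thesis unfolding periodic_map_def periodic_map_of_def by blast
qed

section \<open>Geometric sums along residue classes\<close>

text \<open>
  The coefficient with which the pole of index \<open>r\<close> enters the first component of the \<open>n\<close>-th iterate
  when the second components repeat with period \<open>K\<close>. Each step multiplies the first component by \<open>a\<close>
  and adds one new summand, of index \<open>n mod K\<close>; thus \<open>weight a K n r\<close> is the sum of \<open>a ^ (n - 1 - j)\<close>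
  over all \<open>j < n\<close> with \<open>j mod K = r\<close>.
\<close>

fun weight :: "complex \<Rightarrow> nat \<Rightarrow> nat \<Rightarrow> nat \<Rightarrow> complex" where
  "weight a K 0 r = 0"
| "weight a K (Suc n) r = a * weight a K n r + of_bool (n mod K = r)"

lemma weight_early: "n \<le> r \<Longrightarrow> r < K \<Longrightarrow> weight a K n r = 0"
  by (induction n) auto

lemma add_mod_ne:
  assumes "r < K" "0 < t" "t < K"
  shows "(r + q * K + t) mod K \<noteq> (r::nat)"
proof
  assume "(r + q * K + t) mod K = r"
  then have "(r + t) mod K = r" by (metis add.commute add.left_commute mod_mult_self1)
  then show False using assms by (cases "r + t < K") (auto simp: le_mod_geq)
qed

text \<open>
  Between two consecutive visits of the index \<open>r\<close> the weight is only multiplied by \<open>a\<close>, and from visit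
  to visit it runs through the partial sums of the geometric series in \<open>a ^ K\<close>. This is how the sums
  of the theorem arise: they decide whether a pole cancels.
\<close>

lemma weight_eq:
  assumes "r < K" "t < K"
  shows "weight a K (Suc (r + q * K + t)) r = a ^ t * (\<Sum>i\<le>q. a ^ (i * K))"
  using assms(2)
proof (induction q arbitrary: t)
  case 0
  then show ?case
  proof (induction t)
    case 0
    then show ?case using assms by (simp add: weight_early)
  next
    case (Suc t)
    have "(r + Suc t) mod K \<noteq> r"
      using add_mod_ne[OF assms(1), of "Suc t" 0] Suc.prems by simp
    then show ?case using Suc by simp
  qed
next
  case (Suc q)
  have shift: "r + Suc q * K = Suc (r + q * K + (K - 1))" using assms by simp
  from Suc.prems show ?case
  proof (induction t)
    case 0
    have "weight a K (r + Suc q * K) r = a ^ (K - 1) * (\<Sum>i\<le>q. a ^ (i * K))"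
      unfolding shift by (rule Suc.IH) (use assms in auto)
    then have "weight a K (Suc (r + Suc q * K)) r = a ^ K * (\<Sum>i\<le>q. a ^ (i * K)) + 1"
      using assms(1) unfolding weight.simps
      by (simp add: power_eq_if[of a K] del: mult_Suc)
    then show ?case
      by (simp add: sum.atMost_Suc_shift sum_distrib_left power_add del: sum.atMost_Suc)
  next
    case (Suc t)
    have "(r + Suc q * K + Suc t) mod K \<noteq> r"
      using add_mod_ne[OF assms(1), of "Suc t" "Suc q"] Suc.prems by simp
    then show ?case using Suc by simp
  qed
qed

text \<open>
  After \<open>m\<close> steps the residue classes come up in the same order as from the start. Hence, if the
  weights vanish at \<open>m\<close>, their sequence repeats from there.
\<close>

lemma weight_shift:
  assumes "K dvd m"
  shows "weight a K (m + n) r = a ^ n * weight a K m r + weight a K n r"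
proof (induction n)
  case (Suc n)
  have "(m + n) mod K = n mod K" using assms by (metis add.commute dvd_imp_mod_0 mod_add_right_eq add_0_right)
  then show ?case using Suc by (simp add: algebra_simps)
qed simp

lemma block_div_eq: "s < k \<Longrightarrow> (m * k + s) div k = (m::nat)"
  by simp

lemma weight_after:
  assumes "r < K" "r < n"
  shows "weight a K n r = a ^ ((n - 1 - r) mod K) * (\<Sum>i\<le>(n - 1 - r) div K. a ^ (i * K))"
proof -
  have "n = Suc (r + (n - 1 - r) div K * K + (n - 1 - r) mod K)"
    using assms div_mult_mod_eq[of "n - 1 - r" K] by linarith
  then show ?thesis
    using weight_eq[of r K "(n - 1 - r) mod K" a "(n - 1 - r) div K"] assms by (metis mod_less_divisor not_less_zero gr0I)
qed

section \<open>Nondegeneracy and conjugation to the normal form\<close>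

lemma eval2_affine_poly: "eval2 (affine_poly c0 c1 c2) (x, y) = c0 + c1 * x + c2 * y"
  by (simp add: eval2_def affine_poly_def algebra_simps)

lemma defined_at_fractional_map:
  "defined_at (fractional_map (a0, a1, a2) (b0, b1, b2) (c0, c1, c2)) (x, y)
     \<longleftrightarrow> c0 + c1 * x + c2 * y \<noteq> 0"
  by (simp add: defined_at_def fractional_map_def eval2_affine_poly)

lemma apply_fractional_map:
  "apply_map (fractional_map (a0, a1, a2) (b0, b1, b2) (c0, c1, c2)) (x, y) =
     (a0 + a1 * x + a2 * y, (b0 + b1 * x + b2 * y) / (c0 + c1 * x + c2 * y))"
  by (simp add: apply_map_def fractional_map_def eval2_affine_poly)

lemma infinite_complement_of_finite:
  "finite A \<Longrightarrow> infinite {z :: complex. z \<notin> A}"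
  using infinite_UNIV_char_0 by (metis Compl_eq Diff_infinite_finite Compl_eq_Diff_UNIV)

text \<open>
  A curve contains only finitely many horizontal lines, and it meets every other one in finitely many
  points.
\<close>

lemma algebraic_curve_horizontal_lines:
  assumes "algebraic_curve V"
  obtains E where "finite E" "\<And>y. y \<notin> E \<Longrightarrow> finite {x. (x, y) \<in> V}"
proof -
  obtain p where p: "tdeg2 p > 0" "V = {x. eval2 p x = 0}"
    using assms by (auto simp: algebraic_curve_def)
  have "p \<noteq> 0" using p(1) by (auto simp: tdeg2_def)
  then have "finite ((\<lambda>y. [:y:]) -` {q. poly p q = 0})"
    by (intro finite_vimageI poly_roots_finite) (auto intro: injI)
  moreover have "finite {x. (x, y) \<in> V}" if "y \<notin> (\<lambda>y. [:y:]) -` {q. poly p q = 0}" for y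
    using that poly_roots_finite[of "poly p [:y:]"] by (simp add: p(2) eval2_def)
  ultimately show ?thesis using that by blast
qed

text \<open>
  If $\alpha_1 = 0$ then $f$ is constant on horizontal lines, and if the determinant vanishes then
  the image of $f$ lies in one horizontal line. In both cases $f$ has no inverse off a curve.
\<close>

lemma birational_nondegenerate:
  assumes "birational (fractional_map (\<alpha>\<^sub>0, \<alpha>\<^sub>1, \<alpha>\<^sub>2) (\<beta>\<^sub>0, 0, \<beta>\<^sub>2) (\<gamma>\<^sub>0, 0, \<gamma>\<^sub>2))" "\<gamma>\<^sub>2 \<noteq> 0"
  shows "\<alpha>\<^sub>1 \<noteq> 0" "\<beta>\<^sub>2 * \<gamma>\<^sub>0 - \<beta>\<^sub>0 * \<gamma>\<^sub>2 \<noteq> 0"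
proof -
  define f where "f = fractional_map (\<alpha>\<^sub>0, \<alpha>\<^sub>1, \<alpha>\<^sub>2) (\<beta>\<^sub>0, 0, \<beta>\<^sub>2) (\<gamma>\<^sub>0, 0, \<gamma>\<^sub>2)"
  obtain V g where V: "algebraic_curve V"
    and fg: "\<And>x. x \<notin> V \<Longrightarrow> defined_at f (apply_map g x) \<and> apply_map f (apply_map g x) = x"
    and gf: "\<And>x. x \<notin> V \<Longrightarrow> apply_map g (apply_map f x) = x"
    using assms(1) unfolding birational_def f_def[symmetric] by blast
  obtain E where E: "finite E" "\<And>y. y \<notin> E \<Longrightarrow> finite {x. (x, y) \<in> V}"
    using algebraic_curve_horizontal_lines[OF V] by blast
  have inf: "infinite {x. (x, y) \<notin> V}" if "y \<notin> E" for y
    using infinite_complement_of_finite[OF E(2)[OF that]] by simp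
  show "\<alpha>\<^sub>1 \<noteq> 0"
  proof
    assume "\<alpha>\<^sub>1 = 0"
    obtain y where y: "y \<notin> E" using infinite_complement_of_finite[OF E(1)]
      by (metis (mono_tags, lifting) Collect_empty_eq infinite_imp_nonempty)
    obtain x where x: "(x, y) \<notin> V" using inf[OF y] by (metis (mono_tags, lifting) Collect_empty_eq infinite_imp_nonempty)
    obtain x' where x': "(x', y) \<notin> V" "x' \<noteq> x"
      using infinite_remove[OF inf[OF y], of x] infinite_imp_nonempty by blast
    have "apply_map f (x, y) = apply_map f (x', y)"
      by (simp add: f_def apply_fractional_map \<open>\<alpha>\<^sub>1 = 0\<close>)
    then show False using gf[OF x] gf[OF x'(1)] x'(2) by simp
  qed
  show "\<beta>\<^sub>2 * \<gamma>\<^sub>0 - \<beta>\<^sub>0 * \<gamma>\<^sub>2 \<noteq> 0"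
  proof
    assume det: "\<beta>\<^sub>2 * \<gamma>\<^sub>0 - \<beta>\<^sub>0 * \<gamma>\<^sub>2 = 0"
    \<comment> \<open>The second component of \<open>f\<close> is the constant
      $\beta_2/\gamma_2$, but a point off the curve and off this line is in the image.\<close>
    have "finite (insert (\<beta>\<^sub>2 / \<gamma>\<^sub>2) E)" using E(1) by simp
    then obtain y where y: "y \<notin> E" "y \<noteq> \<beta>\<^sub>2 / \<gamma>\<^sub>2"
      using infinite_imp_nonempty[OF infinite_complement_of_finite] by blast
    obtain x where x: "(x, y) \<notin> V" using infinite_imp_nonempty[OF inf[OF y(1)]] by blast
    obtain x' y' where g: "apply_map g (x, y) = (x', y')" by force
    have "\<gamma>\<^sub>0 + \<gamma>\<^sub>2 * y' \<noteq> 0" "(\<beta>\<^sub>0 + \<beta>\<^sub>2 * y') / (\<gamma>\<^sub>0 + \<gamma>\<^sub>2 * y') = y"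
      using fg[OF x] by (simp_all add: g f_def defined_at_fractional_map apply_fractional_map)
    then have "(\<beta>\<^sub>0 + \<beta>\<^sub>2 * y') * \<gamma>\<^sub>2 = y * \<gamma>\<^sub>2 * (\<gamma>\<^sub>0 + \<gamma>\<^sub>2 * y')" by (auto simp: field_simps)
    moreover have "(\<beta>\<^sub>0 + \<beta>\<^sub>2 * y') * \<gamma>\<^sub>2 = \<beta>\<^sub>2 * (\<gamma>\<^sub>0 + \<gamma>\<^sub>2 * y')"
      using det by (simp add: algebra_simps)
    ultimately have "y * \<gamma>\<^sub>2 = \<beta>\<^sub>2" using \<open>\<gamma>\<^sub>0 + \<gamma>\<^sub>2 * y' \<noteq> 0\<close> by simp
    then show False using y(2) assms(2) by (simp add: field_simps)
  qed
qed

text \<open>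
  Translating $y$ by $\beta_2/\gamma_2 = h(\infty)$ moves $h(\infty)$ to 0, which makes the numerator
  constant. Scaling $x$ by \<open>q\<close> divides the coefficient $\alpha_2$ of the first component by \<open>q\<close>;
  so \<open>q\<close> is chosen as $\alpha_2$ to make this coefficient 1, and as 1 if it is 0 already.
\<close>

lemma normal_form_exists:
  assumes "\<gamma>\<^sub>2 \<noteq> 0" "\<alpha>\<^sub>1 \<noteq> 0" "\<beta>\<^sub>2 * \<gamma>\<^sub>0 - \<beta>\<^sub>0 * \<gamma>\<^sub>2 \<noteq> 0"
  assumes q: "q \<noteq> 0" "e * q = \<alpha>\<^sub>2"
  shows "\<exists>\<phi> a0 a1 b0 c0. affine_change \<phi> \<and> a1 \<noteq> 0 \<and> b0 \<noteq> 0 \<and>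
    conjugate_by \<phi> (fractional_map (\<alpha>\<^sub>0, \<alpha>\<^sub>1, \<alpha>\<^sub>2) (\<beta>\<^sub>0, 0, \<beta>\<^sub>2) (\<gamma>\<^sub>0, 0, \<gamma>\<^sub>2))
      (fractional_map (a0, a1, e) (b0, 0, 0) (c0, 0, 1))"
proof -
  define \<phi> :: "complex \<times> complex \<Rightarrow> complex \<times> complex"
    where "\<phi> = (\<lambda>(x, y). (1 / q * x + 0 * y + 0, 0 * x + 1 * y + (- \<beta>\<^sub>2 / \<gamma>\<^sub>2)))"
  have "affine_change \<phi>"
    unfolding affine_change_def \<phi>_def using q(1)
    by (intro exI[of _ "1 / q"] exI[of _ 0] exI[of _ 1] exI[of _ "- \<beta>\<^sub>2 / \<gamma>\<^sub>2"] conjI refl) simp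
  moreover define b0 where "b0 = (\<beta>\<^sub>0 * \<gamma>\<^sub>2 - \<beta>\<^sub>2 * \<gamma>\<^sub>0) / \<gamma>\<^sub>2 ^ 2"
  then have "b0 \<noteq> 0" using assms by auto
  moreover have "conjugate_by \<phi> (fractional_map (\<alpha>\<^sub>0, \<alpha>\<^sub>1, \<alpha>\<^sub>2) (\<beta>\<^sub>0, 0, \<beta>\<^sub>2) (\<gamma>\<^sub>0, 0, \<gamma>\<^sub>2))
      (fractional_map ((\<alpha>\<^sub>0 + \<alpha>\<^sub>2 * \<beta>\<^sub>2 / \<gamma>\<^sub>2) / q, \<alpha>\<^sub>1, e) (b0, 0, 0) ((\<gamma>\<^sub>0 + \<beta>\<^sub>2) / \<gamma>\<^sub>2, 0, 1))"
    unfolding conjugate_by_def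
  proof (intro allI impI, clarify)
    fix x y
    assume "defined_at (fractional_map (\<alpha>\<^sub>0, \<alpha>\<^sub>1, \<alpha>\<^sub>2) (\<beta>\<^sub>0, 0, \<beta>\<^sub>2) (\<gamma>\<^sub>0, 0, \<gamma>\<^sub>2)) (x, y)"
    then have nz: "\<gamma>\<^sub>0 + \<gamma>\<^sub>2 * y \<noteq> 0" by (simp add: defined_at_fractional_map)
    have 1: "(\<alpha>\<^sub>0 + \<alpha>\<^sub>1 * x + \<alpha>\<^sub>2 * y) / q =
      (\<alpha>\<^sub>0 + \<alpha>\<^sub>2 * \<beta>\<^sub>2 / \<gamma>\<^sub>2) / q + \<alpha>\<^sub>1 * (x / q) + e * (y - \<beta>\<^sub>2 / \<gamma>\<^sub>2)"
      unfolding q(2)[symmetric] using q(1) by (simp add: add_divide_distrib right_diff_distrib)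
    have denom: "(\<gamma>\<^sub>0 + \<beta>\<^sub>2) / \<gamma>\<^sub>2 + (y - \<beta>\<^sub>2 / \<gamma>\<^sub>2) = (\<gamma>\<^sub>0 + \<gamma>\<^sub>2 * y) / \<gamma>\<^sub>2"
      using assms(1) by (simp add: add_divide_distrib)
    have "b0 * \<gamma>\<^sub>2 ^ 2 = \<beta>\<^sub>0 * \<gamma>\<^sub>2 - \<beta>\<^sub>2 * \<gamma>\<^sub>0"
      using assms(1) by (simp add: b0_def)
    then have "(\<beta>\<^sub>0 + \<beta>\<^sub>2 * y) * \<gamma>\<^sub>2 - \<beta>\<^sub>2 * (\<gamma>\<^sub>0 + \<gamma>\<^sub>2 * y) = b0 * \<gamma>\<^sub>2 * \<gamma>\<^sub>2"
      by (simp add: power2_eq_square algebra_simps)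
    then have "(\<beta>\<^sub>0 + \<beta>\<^sub>2 * y) / (\<gamma>\<^sub>0 + \<gamma>\<^sub>2 * y) - \<beta>\<^sub>2 / \<gamma>\<^sub>2
        = b0 * \<gamma>\<^sub>2 * \<gamma>\<^sub>2 / ((\<gamma>\<^sub>0 + \<gamma>\<^sub>2 * y) * \<gamma>\<^sub>2)"
      using nz assms(1) by (simp add: diff_frac_eq)
    then have 2: "(\<beta>\<^sub>0 + \<beta>\<^sub>2 * y) / (\<gamma>\<^sub>0 + \<gamma>\<^sub>2 * y) - \<beta>\<^sub>2 / \<gamma>\<^sub>2 =
      b0 / ((\<gamma>\<^sub>0 + \<beta>\<^sub>2) / \<gamma>\<^sub>2 + (y - \<beta>\<^sub>2 / \<gamma>\<^sub>2))"
      unfolding denom using assms(1) by (simp only: mult_divide_mult_cancel_right divide_divide_eq_right simp_thms)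
    show "\<phi> (apply_map (fractional_map (\<alpha>\<^sub>0, \<alpha>\<^sub>1, \<alpha>\<^sub>2) (\<beta>\<^sub>0, 0, \<beta>\<^sub>2) (\<gamma>\<^sub>0, 0, \<gamma>\<^sub>2)) (x, y)) =
        apply_map (fractional_map ((\<alpha>\<^sub>0 + \<alpha>\<^sub>2 * \<beta>\<^sub>2 / \<gamma>\<^sub>2) / q, \<alpha>\<^sub>1, e) (b0, 0, 0)
          ((\<gamma>\<^sub>0 + \<beta>\<^sub>2) / \<gamma>\<^sub>2, 0, 1)) (\<phi> (x, y))"
      using 1 2 by (simp add: \<phi>_def apply_fractional_map)
  qed
  ultimately show ?thesis using assms(2) by blast
qed

text \<open>
  What all normal forms of $f$ share with $f$. A conjugation has to map horizontal lines to horizontal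
  lines: restricted to such a line, the second component of $\varphi \circ f$ is affine in $x$, whereas that of
  $f' \circ \varphi$ has a pole if the second component of $\varphi$ involves $x$. Hence $\varphi$ is triangular; this
  preserves the multiplier $\alpha_1$ and conjugates the two Moebius maps by an affine map of the line,
  so the traces and determinants of their matrices agree up to a scalar factor \<open>s\<close> of the matrix.
\<close>

lemma conjugation_invariants:
  assumes "\<gamma>\<^sub>2 \<noteq> 0" "\<alpha>\<^sub>1 \<noteq> 0" "b0 \<noteq> 0"
    and "affine_change \<phi>"
    and conj: "conjugate_by \<phi> (fractional_map (\<alpha>\<^sub>0, \<alpha>\<^sub>1, \<alpha>\<^sub>2) (\<beta>\<^sub>0, 0, \<beta>\<^sub>2) (\<gamma>\<^sub>0, 0, \<gamma>\<^sub>2))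
      (fractional_map (a0, a1, a2) (b0, 0, 0) (c0, 0, 1))"
  shows "a1 = \<alpha>\<^sub>1"
    and "\<exists>s. s \<noteq> 0 \<and> c0 = s * (\<beta>\<^sub>2 + \<gamma>\<^sub>0) \<and> - b0 = s ^ 2 * (\<beta>\<^sub>2 * \<gamma>\<^sub>0 - \<beta>\<^sub>0 * \<gamma>\<^sub>2)"
proof -
  obtain a b c d s t where abcd: "a * d - b * c \<noteq> 0"
    and \<phi>: "\<phi> = (\<lambda>(x, y). (a * x + b * y + s, c * x + d * y + t))"
    using assms(4) unfolding affine_change_def by blast
  define h where "h y = (\<beta>\<^sub>0 + \<beta>\<^sub>2 * y) / (\<gamma>\<^sub>0 + \<gamma>\<^sub>2 * y)" for y
  have E: "a * (\<alpha>\<^sub>0 + \<alpha>\<^sub>1 * x + \<alpha>\<^sub>2 * y) + b * h y + s =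
        a0 + a1 * (a * x + b * y + s) + a2 * (c * x + d * y + t)"
      "c * (\<alpha>\<^sub>0 + \<alpha>\<^sub>1 * x + \<alpha>\<^sub>2 * y) + d * h y + t = b0 / (c0 + (c * x + d * y + t))"
    if "\<gamma>\<^sub>0 + \<gamma>\<^sub>2 * y \<noteq> 0" "c0 + (c * x + d * y + t) \<noteq> 0" for x y
    using conj[unfolded conjugate_by_def, rule_format, of "(x, y)"] that
    by (simp_all add: \<phi> apply_fractional_map defined_at_fractional_map h_def)
  have c: "c = 0"
  proof (rule ccontr)
    assume c: "c \<noteq> 0"
    \<comment> \<open>On the line where the denominator of \<open>f\<close> equals 1, let
      \<open>u\<close> be the denominator of the normal form; as $c \neq 0$, it takes all nonzero
      values.\<close>
    define y where "y = (1 - \<gamma>\<^sub>0) / \<gamma>\<^sub>2"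
    have y: "\<gamma>\<^sub>0 + \<gamma>\<^sub>2 * y \<noteq> 0" using assms(1) by (simp add: y_def)
    define e where "e = c * (\<alpha>\<^sub>0 + \<alpha>\<^sub>2 * y) + d * h y + t - \<alpha>\<^sub>1 * (c0 + d * y + t)"
    have *: "\<alpha>\<^sub>1 * u + e = b0 / u" if "u \<noteq> 0" for u
    proof -
      define x where "x = (u - (c0 + d * y + t)) / c"
      have cx: "c * x = u - (c0 + d * y + t)" using c by (simp add: x_def)
      then have u: "c0 + (c * x + d * y + t) = u" by simp
      have "c * (\<alpha>\<^sub>0 + \<alpha>\<^sub>1 * x + \<alpha>\<^sub>2 * y) + d * h y + t = b0 / u"
        using E(2)[OF y, of x] that unfolding u by blast
      moreover have "c * (\<alpha>\<^sub>0 + \<alpha>\<^sub>1 * x + \<alpha>\<^sub>2 * y) = c * (\<alpha>\<^sub>0 + \<alpha>\<^sub>2 * y) + \<alpha>\<^sub>1 * (c * x)"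
        by (simp add: algebra_simps)
      ultimately show ?thesis by (simp add: e_def cx algebra_simps)
    qed
    have u: "\<alpha>\<^sub>1 + e = b0" "- \<alpha>\<^sub>1 + e = - b0" "4 * \<alpha>\<^sub>1 + 2 * e = b0"
      using *[of 1] *[of "- 1"] *[of 2] by (simp_all add: field_simps)
    have "2 * e = (\<alpha>\<^sub>1 + e) + (- \<alpha>\<^sub>1 + e)" by simp
    then have "e = 0" unfolding u by simp
    then have "4 * \<alpha>\<^sub>1 = \<alpha>\<^sub>1" using u by simp
    moreover have "3 * \<alpha>\<^sub>1 = 4 * \<alpha>\<^sub>1 - \<alpha>\<^sub>1" by simp
    ultimately have "\<alpha>\<^sub>1 = 0" by simp
    then show False using assms(2) by simp
  qed
  have ad: "a \<noteq> 0" "d \<noteq> 0" using abcd c by auto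
  define E' where "E' = {- \<gamma>\<^sub>0 / \<gamma>\<^sub>2, - (c0 + t) / d}"
  have E': "\<gamma>\<^sub>0 + \<gamma>\<^sub>2 * y \<noteq> 0" "c0 + (c * x + d * y + t) \<noteq> 0" if "y \<notin> E'" for x y
    using that assms(1) ad(2) c by (auto simp: E'_def field_simps add_eq_0_iff)
  have inf: "infinite {y. y \<notin> E'}" by (rule infinite_complement_of_finite) (simp add: E'_def)
  then obtain y where y: "y \<notin> E'" using infinite_imp_nonempty by blast
  define G where "G = a * (\<alpha>\<^sub>0 + \<alpha>\<^sub>2 * y) + b * h y + s"
  define H where "H = a0 + a1 * (b * y + s) + a2 * (d * y + t)"
  have "G + a * \<alpha>\<^sub>1 * x = H + a1 * a * x" for x
    using E(1)[OF E'(1)[OF y] E'(2)[OF y, of x]] c by (simp add: G_def H_def algebra_simps)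
  from this[of 0] this[of 1] have "a * \<alpha>\<^sub>1 = a1 * a" by simp
  then show "a1 = \<alpha>\<^sub>1" using ad by simp
  \<comment> \<open>The second components agree at all but at most two values of
    \<open>y\<close>, so the coefficients of the polynomial identity that clears denominators
    vanish.\<close>
  define A where "A = (d * \<beta>\<^sub>0 + t * \<gamma>\<^sub>0) * (c0 + t) - b0 * \<gamma>\<^sub>0"
  define B where "B = (d * \<beta>\<^sub>0 + t * \<gamma>\<^sub>0) * d + (d * \<beta>\<^sub>2 + t * \<gamma>\<^sub>2) * (c0 + t) - b0 * \<gamma>\<^sub>2"
  define C where "C = (d * \<beta>\<^sub>2 + t * \<gamma>\<^sub>2) * d"
  have "poly [:A, B, C:] y = 0" if "y \<notin> E'" for y
  proof -
    note nz = E'(1)[OF that] E'(2)[OF that, of 0]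
    have "(d * (\<beta>\<^sub>0 + \<beta>\<^sub>2 * y) + t * (\<gamma>\<^sub>0 + \<gamma>\<^sub>2 * y)) / (\<gamma>\<^sub>0 + \<gamma>\<^sub>2 * y) = b0 / (c0 + d * y + t)"
    proof -
      have "(d * p + t * q) / q = d * (p / q) + t" if "q \<noteq> 0" for p q
        using that by (simp add: add_divide_distrib)
      then have "(d * (\<beta>\<^sub>0 + \<beta>\<^sub>2 * y) + t * (\<gamma>\<^sub>0 + \<gamma>\<^sub>2 * y)) / (\<gamma>\<^sub>0 + \<gamma>\<^sub>2 * y) = d * h y + t"
        unfolding h_def using nz(1) by blast
      also have "\<dots> = b0 / (c0 + d * y + t)"
        using E(2)[OF nz] c by (simp add: add.assoc)
      finally show ?thesis .
    qed
    then have "(d * (\<beta>\<^sub>0 + \<beta>\<^sub>2 * y) + t * (\<gamma>\<^sub>0 + \<gamma>\<^sub>2 * y)) * (c0 + d * y + t) = b0 * (\<gamma>\<^sub>0 + \<gamma>\<^sub>2 * y)"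
      using nz c by (subst (asm) frac_eq_eq) (simp_all add: add.assoc)
    then show ?thesis by (simp add: A_def B_def C_def algebra_simps)
  qed
  then have "{y. y \<notin> E'} \<subseteq> {y. poly [:A, B, C:] y = 0}" by blast
  then have "[:A, B, C:] = 0" using inf poly_roots_finite finite_subset by blast
  then have ABC: "A = 0" "B = 0" "C = 0" by simp_all
  have t: "t = - d * \<beta>\<^sub>2 / \<gamma>\<^sub>2"
  proof -
    have "d * \<beta>\<^sub>2 + t * \<gamma>\<^sub>2 = 0" using ABC(3) ad by (simp add: C_def)
    then show ?thesis using assms(1) by (simp add: field_simps add_eq_0_iff)
  qed
  define w where "w = d * \<beta>\<^sub>0 + t * \<gamma>\<^sub>0"
  have w: "w = d / \<gamma>\<^sub>2 * (\<beta>\<^sub>0 * \<gamma>\<^sub>2 - \<beta>\<^sub>2 * \<gamma>\<^sub>0)" using assms(1) by (simp add: w_def t field_simps)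
  have "d * \<beta>\<^sub>2 + t * \<gamma>\<^sub>2 = 0" using assms(1) by (simp add: t)
  then have b0: "b0 = w * (d / \<gamma>\<^sub>2)" using ABC(2) assms(1) by (simp add: B_def w_def field_simps)
  then have "w \<noteq> 0" using assms(3) by auto
  moreover have "w * (c0 + t) = w * (d / \<gamma>\<^sub>2 * \<gamma>\<^sub>0)" using ABC(1) by (simp add: A_def b0 flip: w_def)
  ultimately have "c0 + t = d / \<gamma>\<^sub>2 * \<gamma>\<^sub>0" by (simp only: mult_cancel_left simp_thms)
  then have "c0 = d / \<gamma>\<^sub>2 * (\<beta>\<^sub>2 + \<gamma>\<^sub>0)" using assms(1) by (simp add: t field_simps)
  moreover have "- b0 = (d / \<gamma>\<^sub>2) ^ 2 * (\<beta>\<^sub>2 * \<gamma>\<^sub>0 - \<beta>\<^sub>0 * \<gamma>\<^sub>2)"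
  proof -
    have "- (e * z * e) = e ^ 2 * (- z)" for e z :: complex by (simp add: power2_eq_square)
    then show ?thesis unfolding b0 w by (simp only: minus_diff_eq)
  qed
  ultimately show "\<exists>s. s \<noteq> 0 \<and> c0 = s * (\<beta>\<^sub>2 + \<gamma>\<^sub>0) \<and> - b0 = s ^ 2 * (\<beta>\<^sub>2 * \<gamma>\<^sub>0 - \<beta>\<^sub>0 * \<gamma>\<^sub>2)"
    using ad assms(1) by (intro exI[of _ "d / \<gamma>\<^sub>2"]) auto
qed

section \<open>Poles and degrees of the iterates\<close>

locale triangular_map =
  fixes \<alpha>\<^sub>0 \<alpha>\<^sub>1 \<alpha>\<^sub>2 \<beta>\<^sub>0 \<beta>\<^sub>2 \<gamma>\<^sub>0 \<gamma>\<^sub>2 :: complex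
  assumes \<alpha>\<^sub>1: "\<alpha>\<^sub>1 \<noteq> 0" and \<gamma>\<^sub>2: "\<gamma>\<^sub>2 \<noteq> 0" and det: "\<beta>\<^sub>2 * \<gamma>\<^sub>0 - \<beta>\<^sub>0 * \<gamma>\<^sub>2 \<noteq> 0"
begin

definition f :: ratmap where
  "f = fractional_map (\<alpha>\<^sub>0, \<alpha>\<^sub>1, \<alpha>\<^sub>2) (\<beta>\<^sub>0, 0, \<beta>\<^sub>2) (\<gamma>\<^sub>0, 0, \<gamma>\<^sub>2)"

definition u :: "nat \<Rightarrow> complex" where
  "u = lucas (\<beta>\<^sub>2 + \<gamma>\<^sub>0) (\<beta>\<^sub>2 * \<gamma>\<^sub>0 - \<beta>\<^sub>0 * \<gamma>\<^sub>2)"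

text \<open>
  With $M$ the matrix of $h$ acting on $[x_2 : x_0]$, the forms $N_n$ and $L_n$ are the entries of
  $M^n (x_2, x_0)$, so that the second component of the \<open>n\<close>-th iterate is $N_n / L_n$. The zero of $L_n$
  is $h^{-n}(\infty)$, where the pole of $h^n$ is.
\<close>

definition N :: "nat \<Rightarrow> terpoly" where
  "N n = scalar (u (Suc n) - \<gamma>\<^sub>0 * u n) * X2 + scalar (\<beta>\<^sub>0 * u n) * X0"

definition L :: "nat \<Rightarrow> terpoly" where
  "L n = scalar (\<gamma>\<^sub>2 * u n) * X2 + scalar (u (Suc n) - \<beta>\<^sub>2 * u n) * X0"

lemma u_simps: "u 0 = 0" "u (Suc 0) = 1"
  "u (Suc (Suc n)) = (\<beta>\<^sub>2 + \<gamma>\<^sub>0) * u (Suc n) - (\<beta>\<^sub>2 * \<gamma>\<^sub>0 - \<beta>\<^sub>0 * \<gamma>\<^sub>2) * u n"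
  by (simp_all add: u_def)

lemma NL_0: "N 0 = X2" "L 0 = X0"
  by (simp_all add: N_def L_def u_simps scalar_hom)

lemma NL_Suc:
  "N (Suc n) = scalar \<beta>\<^sub>2 * N n + scalar \<beta>\<^sub>0 * L n"
  "L (Suc n) = scalar \<gamma>\<^sub>2 * N n + scalar \<gamma>\<^sub>0 * L n"
  by (simp_all add: N_def L_def u_simps scalar_hom algebra_simps)

text \<open>
  This is $M^{n+m} = M^m M^n$ with $M^m$ expressed through the Lucas sequence. It shows that $L_n$ and
  $L_{n+m}$ are proportional if $u_m = 0$, and only then.
\<close>

lemma NL_add:
  "N (n + m) = scalar (u (Suc m) - \<gamma>\<^sub>0 * u m) * N n + scalar (\<beta>\<^sub>0 * u m) * L n"
  "L (n + m) = scalar (\<gamma>\<^sub>2 * u m) * N n + scalar (u (Suc m) - \<beta>\<^sub>2 * u m) * L n"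
proof (induction m)
  case 0
  case 1 show ?case by (simp add: u_simps scalar_hom)
  case 2 show ?case by (simp add: u_simps scalar_hom)
next
  case (Suc m)
  case 1 show ?case unfolding add_Suc_right NL_Suc Suc by (simp add: u_simps scalar_hom algebra_simps)
  case 2 show ?case unfolding add_Suc_right NL_Suc Suc by (simp add: u_simps scalar_hom algebra_simps)
qed

lemma u_Suc_nonzero:
  assumes "u n = 0"
  shows "u (Suc n) \<noteq> 0"
  using lucas_norm[of "\<beta>\<^sub>2 + \<gamma>\<^sub>0" "\<beta>\<^sub>2 * \<gamma>\<^sub>0 - \<beta>\<^sub>0 * \<gamma>\<^sub>2" n] assms det
  by (auto simp: power_0_left simp flip: u_def)

lemma L_nonzero: "L n \<noteq> 0"
  using u_Suc_nonzero[of n] \<gamma>\<^sub>2 by (auto simp: L_def scalar_combination_eq_0_iff)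

text \<open>
  $M$ is invertible, so a common divisor of $N_n$ and $L_n$ also divides $x_2$ and $x_0$.
\<close>

lemma is_unit_if_dvd_N_L:
  assumes "p dvd N n" "p dvd L n"
  shows "is_unit p"
  using assms
proof (induction n)
  case 0
  then show ?case by (auto simp: NL_0 X2_def intro: is_unit_if_dvd_X0)
next
  case (Suc n)
  have "scalar (\<beta>\<^sub>2 * \<gamma>\<^sub>0 - \<beta>\<^sub>0 * \<gamma>\<^sub>2) * N n = scalar \<gamma>\<^sub>0 * N (Suc n) - scalar \<beta>\<^sub>0 * L (Suc n)"
    "scalar (\<beta>\<^sub>2 * \<gamma>\<^sub>0 - \<beta>\<^sub>0 * \<gamma>\<^sub>2) * L n = scalar \<beta>\<^sub>2 * L (Suc n) - scalar \<gamma>\<^sub>2 * N (Suc n)"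
    by (simp_all add: NL_Suc scalar_hom algebra_simps)
  moreover have "p dvd scalar \<gamma>\<^sub>0 * N (Suc n) - scalar \<beta>\<^sub>0 * L (Suc n)"
    "p dvd scalar \<beta>\<^sub>2 * L (Suc n) - scalar \<gamma>\<^sub>2 * N (Suc n)"
    using Suc.prems by (auto intro!: dvd_diff dvd_mult)
  ultimately have "p dvd scalar (\<beta>\<^sub>2 * \<gamma>\<^sub>0 - \<beta>\<^sub>0 * \<gamma>\<^sub>2) * N n" "p dvd scalar (\<beta>\<^sub>2 * \<gamma>\<^sub>0 - \<beta>\<^sub>0 * \<gamma>\<^sub>2) * L n"
    by simp_all
  then have "p dvd N n" "p dvd L n"
    using is_unit_scalar[OF det] by (simp_all add: dvd_mult_unit_iff')
  then show ?case by (rule Suc.IH)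
qed

text \<open>
  Modulo $p$, the form $L_j$ is the multiple $\gamma_2 u_{j-i} N_i$ of $N_i$, and $N_i$ and $L_i$ are coprime.
\<close>

lemma no_common_prime_of_L:
  assumes "prime p" "p dvd L i" "p dvd L j" "i < j" "u (j - i) \<noteq> 0"
  shows False
proof -
  have "L j = scalar (\<gamma>\<^sub>2 * u (j - i)) * N i + scalar (u (Suc (j - i)) - \<beta>\<^sub>2 * u (j - i)) * L i"
    using NL_add(2)[of i "j - i"] assms by simp
  then have "p dvd scalar (\<gamma>\<^sub>2 * u (j - i)) * N i"
    using assms(2,3) by (metis dvd_add_left_iff dvd_mult)
  then have "p dvd N i"
    using is_unit_scalar[of "\<gamma>\<^sub>2 * u (j - i)"] assms \<gamma>\<^sub>2 by (simp add: dvd_mult_unit_iff')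
  then show False using is_unit_if_dvd_N_L assms by (metis not_prime_unit)
qed

text \<open>
  The iterates are computed as rational functions, in the fraction field of the polynomials in
  $x_0, x_1, x_2$; there, a common factor of the three components is invisible.
\<close>

abbreviation \<iota> :: "terpoly \<Rightarrow> terpoly fract" where "\<iota> \<equiv> to_fract"

definition y :: "nat \<Rightarrow> terpoly fract" where
  "y n = \<iota> (N n) / \<iota> (L n)"

lemma y_mod:
  assumes "u K = 0" "K \<ge> 1"
  shows "y j = y (j mod K)"
proof (induction j rule: less_induct)
  case (less j)
  show ?case
  proof (cases "j < K")
    case False
    then have "j = (j - K) + K" by simp
    then have "y j = y (j - K)"
      using u_Suc_nonzero[OF assms(1)] NL_add[of "j - K" K] assms(1)
      by (simp add: y_def scalar_hom)
    also have "\<dots> = y ((j - K) mod K)" using False assms(2) by (intro less) auto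
    finally show ?thesis using False by (simp add: le_mod_geq)
  qed simp
qed

fun \<kappa> :: "nat \<Rightarrow> complex" where
  "\<kappa> 0 = 0"
| "\<kappa> (Suc n) = \<alpha>\<^sub>0 + \<alpha>\<^sub>1 * \<kappa> n"

abbreviation w :: "nat \<Rightarrow> nat \<Rightarrow> nat \<Rightarrow> complex" where
  "w \<equiv> weight \<alpha>\<^sub>1"

text \<open>
  In affine coordinates the recursion is $x \mapsto \alpha_0 + \alpha_1 x + \alpha_2 y$, where $y$
  runs through $y_0, y_1, \ldots$; it is solved by a geometric sum over the $y_j$. Where the $y_j$ repeat
  with period \<open>K\<close>, equal ones are collected, which yields the weights and the partial fraction
  decomposition of the first component.
\<close>

lemma iterate_closed_form:
  assumes "K \<ge> 1" "\<And>j. j < n \<Longrightarrow> y j = y (j mod K)"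
    and "proj_iterate n (proj_extension f) = (P0, P1, P2)"
  shows "P0 \<noteq> 0 \<and> \<iota> P2 / \<iota> P0 = y n \<and>
    \<iota> P1 / \<iota> P0 = \<iota> (scalar (\<alpha>\<^sub>1 ^ n)) * (\<iota> X1 / \<iota> X0) + \<iota> (scalar (\<kappa> n))
        + (\<Sum>r<K. \<iota> (scalar (\<alpha>\<^sub>2 * w K n r)) * y r)"
  using assms(2,3)
proof (induction n arbitrary: P0 P1 P2)
  case 0
  have P: "P0 = X0" "P1 = X1" "P2 = X2"
    using 0 by (simp_all add: proj_iterate_def X0_def X1_def X2_def)
  show ?case by (simp add: P y_def NL_0 scalar_hom) (simp add: X0_def)
next
  case (Suc n)
  obtain Q0 Q1 Q2 where Q: "proj_iterate n (proj_extension f) = (Q0, Q1, Q2)"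
    by (metis prod_cases3)
  have IH: "Q0 \<noteq> 0" "\<iota> Q2 / \<iota> Q0 = y n"
    "\<iota> Q1 / \<iota> Q0 = \<iota> (scalar (\<alpha>\<^sub>1 ^ n)) * (\<iota> X1 / \<iota> X0) + \<iota> (scalar (\<kappa> n))
        + (\<Sum>r<K. \<iota> (scalar (\<alpha>\<^sub>2 * w K n r)) * y r)"
    using Suc.IH[OF _ Q] Suc.prems(1) by simp_all
  define D where "D = scalar \<gamma>\<^sub>0 * Q0 + scalar \<gamma>\<^sub>2 * Q2"
  have P: "P0 = Q0 * D"
    "P1 = (scalar \<alpha>\<^sub>0 * Q0 + scalar \<alpha>\<^sub>1 * Q1 + scalar \<alpha>\<^sub>2 * Q2) * D"
    "P2 = Q0 * (scalar \<beta>\<^sub>0 * Q0 + scalar \<beta>\<^sub>2 * Q2)"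
    using Suc.prems(2) Q
    by (auto simp: proj_iterate_def f_def proj_extension_fractional_map[OF \<alpha>\<^sub>1 \<gamma>\<^sub>2] D_def)
  have Q2: "\<iota> Q2 = \<iota> Q0 * \<iota> (N n) / \<iota> (L n)"
    using IH(1,2) L_nonzero[of n] by (simp add: y_def field_simps)
  have D: "\<iota> D = \<iota> Q0 * \<iota> (L (Suc n)) / \<iota> (L n)"
    using L_nonzero[of n] by (simp add: D_def Q2 NL_Suc field_simps)
  then have D0: "D \<noteq> 0" using IH(1) L_nonzero by (metis divide_eq_0_iff mult_eq_0_iff to_fract_eq_0_iff)
  have "\<iota> (scalar \<beta>\<^sub>0 * Q0 + scalar \<beta>\<^sub>2 * Q2) = \<iota> Q0 * \<iota> (N (Suc n)) / \<iota> (L n)"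
    using L_nonzero[of n] by (simp add: Q2 NL_Suc field_simps)
  then have "\<iota> P2 / \<iota> P0 = y (Suc n)"
    using IH(1) L_nonzero[of n] L_nonzero[of "Suc n"]
    by (simp add: P D y_def del: to_fract_add)
  moreover have "\<iota> P1 / \<iota> P0 = \<iota> (scalar (\<alpha>\<^sub>1 ^ Suc n)) * (\<iota> X1 / \<iota> X0) + \<iota> (scalar (\<kappa> (Suc n)))
        + (\<Sum>r<K. \<iota> (scalar (\<alpha>\<^sub>2 * w K (Suc n) r)) * y r)"
  proof -
    have "\<iota> P1 / \<iota> P0 = \<iota> (scalar \<alpha>\<^sub>0) + \<iota> (scalar \<alpha>\<^sub>1) * (\<iota> Q1 / \<iota> Q0) + \<iota> (scalar \<alpha>\<^sub>2) * (\<iota> Q2 / \<iota> Q0)"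
      using IH(1) D0 by (simp add: P field_simps)
    moreover have "(\<Sum>r<K. \<iota> (scalar (\<alpha>\<^sub>2 * w K (Suc n) r)) * y r) =
        (\<Sum>r<K. \<iota> (scalar \<alpha>\<^sub>1) * (\<iota> (scalar (\<alpha>\<^sub>2 * w K n r)) * y r) +
          (if n mod K = r then \<iota> (scalar \<alpha>\<^sub>2) * y r else 0))"
      by (intro sum.cong) (auto simp: scalar_hom algebra_simps)
    moreover have "\<dots> = \<iota> (scalar \<alpha>\<^sub>1) * (\<Sum>r<K. \<iota> (scalar (\<alpha>\<^sub>2 * w K n r)) * y r) + \<iota> (scalar \<alpha>\<^sub>2) * y n"
      using assms(1) Suc.prems(1)[of n] by (simp add: sum.distrib sum_distrib_left)
    ultimately show ?thesis
      unfolding IH(2,3) by (simp add: scalar_hom algebra_simps)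
  qed
  ultimately show ?case using D0 IH(1) by (simp add: P(1))
qed

text \<open>
  The indices \<open>r\<close> for which the line $L_r = 0$ belongs to the poles of the \<open>n\<close>-th iterate in the
  projective plane: $L_0 = x_0$ through the term $\alpha_1^n x_1/x_0$, the pole of $y_n$ in the second
  component, and the poles of those $y_r$ that occur in the first component.
\<close>

definition poles :: "nat \<Rightarrow> nat \<Rightarrow> nat set" where
  "poles K n = {0, n mod K} \<union> {r. r < K \<and> \<alpha>\<^sub>2 * w K n r \<noteq> 0}"

text \<open>
  The degree of an iterate is its number of polar lines. Clearing denominators in the partial fraction
  decomposition with the product of the $L_r$ over all poles yields a coprime triple: at a polar line
  some component has a pole that no other term cancels, as the $L_r$ are pairwise coprime.
  
  The two uses of this are \<open>K = n + 1\<close>, if no two of $L_0, \ldots, L_n$ are proportional, and \<open>K\<close> the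
  period of $h$.
\<close>

lemma iterate_degree_eq_card_poles:
  assumes K: "K \<ge> 1" and indep: "\<And>m. 0 < m \<Longrightarrow> m < K \<Longrightarrow> u m \<noteq> 0"
    and per: "\<And>j. j \<le> n \<Longrightarrow> y j = y (j mod K)"
  shows "iterate_degree f n = card (poles K n)"
proof -
  obtain P0 P1 P2 where P: "proj_iterate n (proj_extension f) = (P0, P1, P2)"
    by (metis prod_cases3)
  have closed: "P0 \<noteq> 0" "\<iota> P2 / \<iota> P0 = y n"
    "\<iota> P1 / \<iota> P0 = \<iota> (scalar (\<alpha>\<^sub>1 ^ n)) * (\<iota> X1 / \<iota> X0) + \<iota> (scalar (\<kappa> n))
        + (\<Sum>r<K. \<iota> (scalar (\<alpha>\<^sub>2 * w K n r)) * y r)"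
    using iterate_closed_form[OF K per P] by simp_all
  define J where "J = poles K n"
  define n' where "n' = n mod K"
  have J: "finite J" "0 \<in> J" "n' \<in> J" "J \<subseteq> {..<K}"
    using K by (auto simp: J_def poles_def n'_def)
  define prodL where "prodL A = (\<Prod>r\<in>A. L r)" for A
  have prodL_remove: "prodL J = L r * prodL (J - {r})" if "r \<in> J" for r
    unfolding prodL_def by (rule prod.remove[OF J(1) that])
  have prodL_nz: "prodL J \<noteq> 0" using J(1) by (simp add: prodL_def L_nonzero)
  define t where "t r = scalar (\<alpha>\<^sub>2 * w K n r) * N r * prodL (J - {r})" for r
  define R1 where "R1 = scalar (\<alpha>\<^sub>1 ^ n) * X1 * prodL (J - {0}) + scalar (\<kappa> n) * prodL J + (\<Sum>r\<in>J. t r)"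
  define R2 where "R2 = N n' * prodL (J - {n'})"
  have frac: "\<iota> (prodL (J - {r})) = \<iota> (prodL J) / \<iota> (L r)" if "r \<in> J" for r
    using prodL_remove[OF that] L_nonzero[of r] by simp
  have hom_NL: "homogeneous 1 (N r)" "homogeneous 1 (L r)" for r
    unfolding N_def L_def
    using homogeneous_mult[OF homogeneous_scalar homogeneous_X(1)]
      homogeneous_mult[OF homogeneous_scalar homogeneous_X(3)]
    by (auto intro!: homogeneous_add)
  have hom_prodL: "homogeneous (card A) (prodL A)" for A
    unfolding prodL_def by (rule homogeneous_prod) (rule hom_NL)
  have hom_term: "homogeneous (card J) (scalar c * Q * prodL (J - {r}))"
    if "r \<in> J" "homogeneous 1 Q" for c r Q
  proof -
    have "0 + 1 + card (J - {r}) = card J" using card_Suc_Diff1[OF J(1) that(1)] by simp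
    then show ?thesis
      using homogeneous_mult[OF homogeneous_mult[OF homogeneous_scalar[of c] that(2)] hom_prodL[of "J - {r}"]]
      by simp
  qed
  have "reduced_degree (P0, P1, P2) = card J"
  proof (rule reduced_degree_eq)
    show "homogeneous (card J) (prodL J)" by (rule hom_prodL)
    show "homogeneous (card J) R1"
      unfolding R1_def t_def using J(2) homogeneous_mult[OF homogeneous_scalar hom_prodL[of J]]
      by (intro homogeneous_add homogeneous_sum hom_term hom_NL homogeneous_X) auto
    show "homogeneous (card J) R2"
      unfolding R2_def using hom_term[OF J(3) hom_NL(1), of 1 n'] by (simp add: scalar_hom)
    show "prodL J \<noteq> 0" "P0 \<noteq> 0" by fact+
    have "\<iota> P2 / \<iota> P0 = y n'" using closed(2) per[of n] unfolding n'_def by (simp only: order_refl)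
    then have "\<iota> P2 = \<iota> P0 * y n'" using closed(1) by (simp add: field_simps)
    moreover have "\<iota> R2 = y n' * \<iota> (prodL J)" by (simp add: R2_def y_def frac[OF J(3)])
    ultimately have "\<iota> (P2 * prodL J) = \<iota> (P0 * R2)" by simp
    then show "P2 * prodL J = P0 * R2" by (simp only: to_fract_eq_iff)
    have "(\<Sum>r<K. \<iota> (scalar (\<alpha>\<^sub>2 * w K n r)) * y r) = (\<Sum>r\<in>J. \<iota> (scalar (\<alpha>\<^sub>2 * w K n r)) * y r)"
      by (rule sum.mono_neutral_right) (use J in \<open>auto simp: J_def poles_def scalar_hom\<close>)
    moreover have "\<iota> R1 = \<iota> (prodL J) * (\<iota> (scalar (\<alpha>\<^sub>1 ^ n)) * (\<iota> X1 / \<iota> X0) + \<iota> (scalar (\<kappa> n))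
        + (\<Sum>r\<in>J. \<iota> (scalar (\<alpha>\<^sub>2 * w K n r)) * y r))"
      using J(2) by (simp add: R1_def t_def frac y_def NL_0 sum_distrib_left algebra_simps)
    ultimately have "\<iota> R1 = \<iota> (prodL J) * (\<iota> P1 / \<iota> P0)" using closed(3) by simp
    then have "\<iota> (P1 * prodL J) = \<iota> (P0 * R1)" using closed(1) by simp
    then show "P1 * prodL J = P0 * R1" by (simp only: to_fract_eq_iff)
  next
    fix p assume p: "prime p" and dvd: "p dvd prodL J" "p dvd R1" "p dvd R2"
    obtain r where r: "r \<in> J" "p dvd L r"
      using dvd(1) p J(1) by (auto simp: prodL_def prime_dvd_prod_iff)
    have not_N: "\<not> p dvd N r" using is_unit_if_dvd_N_L[OF _ r(2)] p by auto
    have not_prodL: "\<not> p dvd prodL (J - {r})"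
    proof
      assume "p dvd prodL (J - {r})"
      then obtain i where i: "i \<in> J" "i \<noteq> r" "p dvd L i"
        using p J(1) by (auto simp: prodL_def prime_dvd_prod_iff)
      show False
        using no_common_prime_of_L[OF p, of i r] no_common_prime_of_L[OF p, of r i] i r J(4) indep
        by (cases "i < r") (auto simp: subset_iff)
    qed
    \<comment> \<open>The prime \<open>p\<close> belongs to the polar line of index
      \<open>r\<close>. If it is that of $y_n$, the second component has a pole there.\<close>
    have "r \<noteq> n'" using dvd(3) not_N not_prodL p by (auto simp: R2_def prime_dvd_mult_iff)
    have dvd_prodL: "p dvd prodL (J - {i})" if "i \<noteq> r" for i
      using r J(1) that p by (auto simp: prodL_def prime_dvd_prod_iff)
    \<comment> \<open>Otherwise it is a pole of the first component: modulo \<open>p\<close>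
      only the singular terms of the decomposition remain.\<close>
    have "p dvd (\<Sum>i\<in>J - {r}. t i)" by (intro dvd_sum) (simp add: t_def dvd_prodL)
    moreover have "R1 = scalar (\<alpha>\<^sub>1 ^ n) * X1 * prodL (J - {0}) + t r + (scalar (\<kappa> n) * prodL J + (\<Sum>i\<in>J - {r}. t i))"
      using sum.remove[OF J(1) r(1), of t] by (simp add: R1_def algebra_simps)
    ultimately have *: "p dvd scalar (\<alpha>\<^sub>1 ^ n) * X1 * prodL (J - {0}) + t r"
      using dvd(1,2) by (metis dvd_add_left_iff dvd_add dvd_mult)
    show False
    proof (cases "r = 0")
      case True
      \<comment> \<open>The polar part at $x_0 = 0$ is a combination of $x_1$ and $x_2$, and
        $x_1$ has the nonzero coefficient $\alpha_1^n$.\<close>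
      define q :: bipoly where "q = [:[:0, \<alpha>\<^sub>1 ^ n:], [:\<alpha>\<^sub>2 * w K n 0:]:]"
      have "[:q:] = scalar (\<alpha>\<^sub>1 ^ n) * X1 + scalar (\<alpha>\<^sub>2 * w K n 0) * N 0"
        by (simp add: q_def NL_0 scalar_def X1_def X2_def)
      then have "[:q:] * prodL (J - {0}) = scalar (\<alpha>\<^sub>1 ^ n) * X1 * prodL (J - {0}) + t r"
        by (simp only: t_def True distrib_right)
      then have "p dvd [:q:] * prodL (J - {0})" using * by (simp only:)
      then have "p dvd [:q:]" using not_prodL True by (simp only: prime_dvd_mult_iff[OF p] simp_thms)
      moreover have "q \<noteq> 0" using \<alpha>\<^sub>1 by (simp add: q_def)
      ultimately have "is_unit p" using r(2) True by (auto simp: NL_0 intro: is_unit_if_dvd_X0)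
      then show False using p by auto
    next
      case False
      then have "p dvd scalar (\<alpha>\<^sub>1 ^ n) * X1 * prodL (J - {0})" using dvd_prodL[of 0] by simp
      then have "p dvd t r" using * by (metis dvd_add_right_iff)
      then have "p dvd scalar (\<alpha>\<^sub>2 * w K n r)" using not_N not_prodL p by (simp add: t_def prime_dvd_mult_iff)
      moreover have "\<alpha>\<^sub>2 * w K n r \<noteq> 0"
        using r(1) False \<open>r \<noteq> n'\<close> by (auto simp: J_def poles_def n'_def)
      ultimately have "is_unit p" using is_unit_scalar dvd_trans by blast
      then show False using p by auto
    qed
  qed
  then show ?thesis by (simp add: iterate_degree_def P J_def)
qed

end

section \<open>Counting poles\<close>

context triangular_map
begin

text \<open>
  As long as the orbit of the poles has not closed up, there is one new pole in each step if $y$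
  enters the first component, and otherwise there are just the poles of $x$ and $y$.
\<close>

lemma degree_before_return:
  assumes "n \<ge> 1" "\<And>m. 0 < m \<Longrightarrow> m \<le> n \<Longrightarrow> u m \<noteq> 0"
  shows "iterate_degree f n = (if \<alpha>\<^sub>2 = 0 then 2 else 1 + n)"
proof -
  have "iterate_degree f n = card (poles (Suc n) n)"
    by (rule iterate_degree_eq_card_poles) (use assms in auto)
  also have "\<dots> = (if \<alpha>\<^sub>2 = 0 then 2 else 1 + n)"
  proof (cases "\<alpha>\<^sub>2 = 0")
    case True
    then show ?thesis using assms(1) unfolding poles_def by simp
  next
    case False
    have "w (Suc n) n r \<noteq> 0" if "r < n" for r
      using that \<alpha>\<^sub>1 by (simp add: weight_after)
    then have "poles (Suc n) n = {..<Suc n}"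
      using False by (auto simp: poles_def less_Suc_eq)
    then show ?thesis using False by simp
  qed
  finally show ?thesis .
qed

lemma seq_period_if_poles_periodic:
  assumes "\<And>n. d n = card (poles k n)" "p \<ge> 1" "\<And>n. n \<ge> 1 \<Longrightarrow> poles k (n + p) = poles k n"
  shows "seq_period p d"
  using assms by (simp add: seq_period_def)

text \<open>
  A smaller period \<open>q\<close> would carry the value 1 from \<open>p\<close> over to $p + q$ and hence to \<open>q\<close>.
\<close>

lemma periodic_seq_ofI:
  assumes "seq_period p d" "d p = 1" "\<And>q. 0 < q \<Longrightarrow> q < p \<Longrightarrow> d q \<noteq> (1::nat)"
  shows "periodic_seq_of p d"
  unfolding periodic_seq_of_def
proof (intro conjI allI impI notI)
  fix q assume q: "q < p" "seq_period q d"
  then have "d (p + q) = d p" "d (q + p) = d q" "0 < q" using assms(1) by (auto simp: seq_period_def)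
  then have "d q = 1" using assms(2) by (simp add: add.commute)
  then show False using assms(3) q(1) \<open>0 < q\<close> by blast
qed fact

context
  fixes k :: nat
  assumes k: "k \<ge> 1" "u k = 0" "\<And>j. 1 \<le> j \<Longrightarrow> j < k \<Longrightarrow> u j \<noteq> 0"
begin

text \<open>
  A Moebius map with $\gamma_2 \neq 0$ is not the identity.
\<close>

lemma period_ge_2: "k \<ge> 2"
  using k u_simps(2) by (cases "k = 1") auto

lemma degree_eq_card_poles: "iterate_degree f n = card (poles k n)"
  by (rule iterate_degree_eq_card_poles) (use k in \<open>auto intro!: y_mod\<close>)

lemma poles_full:
  assumes "\<alpha>\<^sub>2 \<noteq> 0" "n \<ge> k" "\<And>r. r < k \<Longrightarrow> (\<Sum>i\<le>(n - 1 - r) div k. \<alpha>\<^sub>1 ^ (i * k)) \<noteq> 0"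
  shows "poles k n = {..<k}"
  using k(1) assms \<alpha>\<^sub>1 by (auto simp: poles_def weight_after)

text \<open>
  The pole of $y_n$ is then different from the line at infinity.
\<close>

lemma degree_off_multiples:
  assumes "\<not> k dvd n"
  shows "iterate_degree f n \<noteq> 1"
proof -
  have "card {0, n mod k} \<le> card (poles k n)"
    using k(1) by (intro card_mono) (auto simp: poles_def)
  then show ?thesis
    using assms by (simp add: degree_eq_card_poles dvd_eq_mod_eq_0 eq_commute[of 0])
qed

lemma degree_saturates:
  assumes "\<alpha>\<^sub>2 \<noteq> 0" "\<And>m. (\<Sum>i\<le>m. \<alpha>\<^sub>1 ^ (i * k)) \<noteq> 0" "n \<ge> k"
  shows "iterate_degree f n = k"
  using poles_full[OF assms(1,3)] assms(2) by (simp add: degree_eq_card_poles)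

context
  fixes m :: nat
  assumes vanish: "(\<Sum>i\<le>m. \<alpha>\<^sub>1 ^ (i * k)) = 0"
begin

text \<open>
  After \<open>(m + 1) * k\<close> steps each index has been visited exactly \<open>m + 1\<close> times.
\<close>

lemma weight_vanishes:
  assumes "r < k"
  shows "w k ((m + 1) * k) r = 0"
proof -
  have "(m + 1) * k - 1 - r = m * k + (k - 1 - r)" using assms by simp
  then have "((m + 1) * k - 1 - r) div k = m" using block_div_eq[of "k - 1 - r" k m] assms by simp
  moreover have "r < (m + 1) * k" using assms by simp
  ultimately show ?thesis by (simp only: weight_after[OF assms] vanish mult_zero_right)
qed

text \<open>
  By \<open>weight_vanishes\<close> the weights start anew after \<open>(m + 1) * k\<close> steps, and so do the poles.
\<close>

lemma seq_period_degree: "seq_period ((m + 1) * k) (iterate_degree f)"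
proof (rule seq_period_if_poles_periodic[OF degree_eq_card_poles])
  fix n
  have "w k (n + (m + 1) * k) r = w k n r" if "r < k" for r
    using weight_shift[of k "(m + 1) * k" \<alpha>\<^sub>1 n r] weight_vanishes[OF that] by (simp add: add.commute)
  moreover have "(n + (m + 1) * k) mod k = n mod k" by (rule mod_mult_self1)
  ultimately show "poles k (n + (m + 1) * k) = poles k n"
    unfolding poles_def by auto
next
  show "1 \<le> (m + 1) * k" using k(1) by simp
qed

text \<open>
  At \<open>(m + 1) * k\<close> all poles except the line at infinity have cancelled, and the degree is 1. It is
  larger at all smaller indices: at a multiple of \<open>k\<close>, all \<open>k\<close> poles are present by the minimality
  of \<open>m\<close>, and elsewhere the second component is not affine.
\<close>

lemma periodic_seq_of_degree:
  assumes "\<alpha>\<^sub>2 \<noteq> 0" "\<And>j. j < m \<Longrightarrow> (\<Sum>i\<le>j. \<alpha>\<^sub>1 ^ (i * k)) \<noteq> 0"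
  shows "periodic_seq_of ((m + 1) * k) (iterate_degree f)"
proof (rule periodic_seq_ofI[OF seq_period_degree])
  define T where "T = (m + 1) * k"
  have "T mod k = 0" unfolding T_def by (rule mod_mult_self2_is_0)
  moreover have "w k T r = 0" if "r < k" for r using weight_vanishes[OF that] by (simp only: T_def)
  ultimately have "poles k T = {0}" by (auto simp: poles_def)
  then show "iterate_degree f ((m + 1) * k) = 1"
    unfolding degree_eq_card_poles T_def by simp
next
  fix q assume q: "0 < q" "q < (m + 1) * k"
  show "iterate_degree f q \<noteq> 1"
  proof (cases "k dvd q")
    case True
    then obtain j where j: "q = (j + 1) * k"
      using q(1) by (metis Suc_eq_plus1 dvd_def mult.commute mult_0_right not0_implies_Suc not_less_zero)
    have "j < m" using q(2) by (simp add: j)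
    have "(q - 1 - r) div k = j" if "r < k" for r
    proof -
      have "q - 1 - r = j * k + (k - 1 - r)" using that by (simp add: j)
      then show ?thesis using block_div_eq[of "k - 1 - r" k j] that by simp
    qed
    then have "poles k q = {..<k}"
      using assms \<open>j < m\<close> by (intro poles_full) (auto simp: j)
    then show ?thesis using period_ge_2 by (simp add: degree_eq_card_poles)
  next
    case False
    then show ?thesis by (rule degree_off_multiples)
  qed
qed

end

lemma periodic_seq_of_degree_product:
  assumes "\<alpha>\<^sub>2 = 0"
  shows "periodic_seq_of k (iterate_degree f)"
proof (rule periodic_seq_ofI)
  have poles: "poles k n = {0, n mod k}" for n using assms unfolding poles_def by auto
  show "seq_period k (iterate_degree f)"
    by (rule seq_period_if_poles_periodic[OF degree_eq_card_poles k(1)]) (simp add: poles)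
  show "iterate_degree f k = 1" by (simp add: degree_eq_card_poles poles)
  show "iterate_degree f q \<noteq> 1" if "0 < q" "q < k" for q
    using that by (intro degree_off_multiples nat_dvd_not_less)
qed

end

end

section \<open>The degree sequences\<close>

theorem theorem8:
  fixes \<alpha>\<^sub>0 \<alpha>\<^sub>1 \<alpha>\<^sub>2 \<beta>\<^sub>0 \<beta>\<^sub>1 \<beta>\<^sub>2 \<gamma>\<^sub>0 \<gamma>\<^sub>1 \<gamma>\<^sub>2 :: complex
    and f :: ratmap and d :: "nat \<Rightarrow> nat"
  assumes "(\<gamma>\<^sub>1, \<gamma>\<^sub>2) \<noteq> (0, 0)"
    and f: "f = fractional_map (\<alpha>\<^sub>0, \<alpha>\<^sub>1, \<alpha>\<^sub>2) (\<beta>\<^sub>0, \<beta>\<^sub>1, \<beta>\<^sub>2) (\<gamma>\<^sub>0, \<gamma>\<^sub>1, \<gamma>\<^sub>2)"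
    and "birational f"
    and "\<beta>\<^sub>1 * \<gamma>\<^sub>2 - \<beta>\<^sub>2 * \<gamma>\<^sub>1 = 0"
    and "\<gamma>\<^sub>1 = 0"
    and d: "d = iterate_degree f"
  shows
    "(\<alpha>\<^sub>2 \<noteq> 0 \<longrightarrow>
       (\<exists>\<phi> a0 a1 b0 c0. affine_change \<phi> \<and> a1 \<noteq> 0 \<and> b0 \<noteq> 0 \<and>
          conjugate_by \<phi> f (fractional_map (a0, a1, 1) (b0, 0, 0) (c0, 0, 1))) \<and>
       (\<forall>\<phi> a0 a1 b0 c0. affine_change \<phi> \<and> a1 \<noteq> 0 \<and> b0 \<noteq> 0 \<and>
          conjugate_by \<phi> f (fractional_map (a0, a1, 1) (b0, 0, 0) (c0, 0, 1)) \<longrightarrow>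
          (let h = moebius 0 b0 1 c0 in
             (\<not> periodic_map h \<longrightarrow> (\<forall>n\<ge>1. d n = 1 + n)) \<and>
             (\<forall>k. periodic_map_of k h \<and> (\<forall>n. (\<Sum>i\<le>n. a1 ^ (i * k)) \<noteq> 0) \<longrightarrow>
                (\<forall>n. 1 \<le> n \<and> n \<le> k - 1 \<longrightarrow> d n = 1 + n) \<and> (\<forall>n\<ge>k. d n = k)) \<and>
             (\<forall>k n. periodic_map_of k h \<and> (\<Sum>i\<le>n. a1 ^ (i * k)) = 0 \<longrightarrow>
                seq_period ((n + 1) * k) d \<and>
                ((\<forall>m<n. (\<Sum>i\<le>m. a1 ^ (i * k)) \<noteq> 0) \<longrightarrow> periodic_seq_of ((n + 1) * k) d))))) \<and>
     (\<alpha>\<^sub>2 = 0 \<longrightarrow>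
       (\<exists>\<phi> a0 a1 b0 c0. affine_change \<phi> \<and> a1 \<noteq> 0 \<and> b0 \<noteq> 0 \<and>
          conjugate_by \<phi> f (fractional_map (a0, a1, 0) (b0, 0, 0) (c0, 0, 1))) \<and>
       (\<forall>\<phi> a0 a1 b0 c0. affine_change \<phi> \<and> a1 \<noteq> 0 \<and> b0 \<noteq> 0 \<and>
          conjugate_by \<phi> f (fractional_map (a0, a1, 0) (b0, 0, 0) (c0, 0, 1)) \<longrightarrow>
          (let h = moebius 0 b0 1 c0 in
             (\<not> periodic_map h \<longrightarrow> (\<forall>n\<ge>1. d n = 2)) \<and>
             (\<forall>k. periodic_map_of k h \<longrightarrow> periodic_seq_of k d))))"
proof -
  have \<gamma>\<^sub>2: "\<gamma>\<^sub>2 \<noteq> 0" using assms by auto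
  have f': "f = fractional_map (\<alpha>\<^sub>0, \<alpha>\<^sub>1, \<alpha>\<^sub>2) (\<beta>\<^sub>0, 0, \<beta>\<^sub>2) (\<gamma>\<^sub>0, 0, \<gamma>\<^sub>2)"
    using assms \<gamma>\<^sub>2 by auto
  note nondeg = birational_nondegenerate[OF \<open>birational f\<close>[unfolded f'] \<gamma>\<^sub>2]
  interpret T: triangular_map \<alpha>\<^sub>0 \<alpha>\<^sub>1 \<alpha>\<^sub>2 \<beta>\<^sub>0 \<beta>\<^sub>2 \<gamma>\<^sub>0 \<gamma>\<^sub>2
    by unfold_locales (fact nondeg \<gamma>\<^sub>2)+
  have Tf: "d = iterate_degree T.f" by (simp add: d f' T.f_def)
  \<comment> \<open>The data of any normal form that occur in the statement, expressed through
    \<open>f\<close>; the degrees are then computed for \<open>f\<close> itself.\<close>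
  have normal: "a1 = \<alpha>\<^sub>1 \<and>
      (\<forall>k. periodic_map_of k (moebius 0 b0 1 c0) \<longrightarrow>
         k \<ge> 1 \<and> T.u k = 0 \<and> (\<forall>j. 1 \<le> j \<longrightarrow> j < k \<longrightarrow> T.u j \<noteq> 0)) \<and>
      (\<not> periodic_map (moebius 0 b0 1 c0) \<longrightarrow> (\<forall>n\<ge>1. T.u n \<noteq> 0))"
    if "affine_change \<phi>" "b0 \<noteq> 0"
      "conjugate_by \<phi> f (fractional_map (a0, a1, a2) (b0, 0, 0) (c0, 0, 1))"
    for \<phi> a0 a1 a2 b0 c0
  proof -
    note inv = conjugation_invariants[OF \<gamma>\<^sub>2 nondeg(1) that(2,1) that(3)[unfolded f']]
    obtain s where s: "s \<noteq> 0" "c0 = s * (\<beta>\<^sub>2 + \<gamma>\<^sub>0)" "- b0 = s ^ 2 * (\<beta>\<^sub>2 * \<gamma>\<^sub>0 - \<beta>\<^sub>0 * \<gamma>\<^sub>2)"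
      using inv(2) by blast
    have "s * lucas c0 (- b0) n = s ^ n * T.u n" for n
      unfolding s(2,3) T.u_def by (rule lucas_scale)
    then have "lucas c0 (- b0) n = 0 \<longleftrightarrow> T.u n = 0" for n
      using s(1) by (metis mult_eq_0_iff power_eq_0_iff)
    then have "moebius 0 b0 1 c0 ^^ n = id \<longleftrightarrow> T.u n = 0" for n
      by (simp add: moebius_funpow_eq_id_iff[OF that(2)])
    then show ?thesis
      using inv(1) periodic_map_least[of _ "moebius 0 b0 1 c0"] by (auto simp: periodic_map_of_def)
  qed
  show ?thesis
  proof (intro conjI impI allI; (elim conjE)?)
    assume \<alpha>\<^sub>2: "\<alpha>\<^sub>2 \<noteq> 0"
    show "\<exists>\<phi> a0 a1 b0 c0. affine_change \<phi> \<and> a1 \<noteq> 0 \<and> b0 \<noteq> 0 \<and>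
          conjugate_by \<phi> f (fractional_map (a0, a1, 1) (b0, 0, 0) (c0, 0, 1))"
      unfolding f' using normal_form_exists[OF \<gamma>\<^sub>2 nondeg \<alpha>\<^sub>2, of 1] by simp
    fix \<phi> a0 a1 b0 c0
    assume "affine_change \<phi>" "b0 \<noteq> 0" "conjugate_by \<phi> f (fractional_map (a0, a1, 1) (b0, 0, 0) (c0, 0, 1))"
    note nf = normal[OF this]
    then have a1: "a1 = \<alpha>\<^sub>1" by blast
    show "let h = moebius 0 b0 1 c0 in
             (\<not> periodic_map h \<longrightarrow> (\<forall>n\<ge>1. d n = 1 + n)) \<and>
             (\<forall>k. periodic_map_of k h \<and> (\<forall>n. (\<Sum>i\<le>n. a1 ^ (i * k)) \<noteq> 0) \<longrightarrow>
                (\<forall>n. 1 \<le> n \<and> n \<le> k - 1 \<longrightarrow> d n = 1 + n) \<and> (\<forall>n\<ge>k. d n = k)) \<and>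
             (\<forall>k n. periodic_map_of k h \<and> (\<Sum>i\<le>n. a1 ^ (i * k)) = 0 \<longrightarrow>
                seq_period ((n + 1) * k) d \<and>
                ((\<forall>m<n. (\<Sum>i\<le>m. a1 ^ (i * k)) \<noteq> 0) \<longrightarrow> periodic_seq_of ((n + 1) * k) d))"
      unfolding Let_def Tf a1
    proof (intro conjI impI allI; (elim conjE)?)
      fix n :: nat
      assume "\<not> periodic_map (moebius 0 b0 1 c0)" "1 \<le> n"
      then show "iterate_degree T.f n = 1 + n"
        using T.degree_before_return[of n] nf \<alpha>\<^sub>2 by simp
    next
      fix k n
      assume "periodic_map_of k (moebius 0 b0 1 c0)" "1 \<le> n" "n \<le> k - 1"
      then show "iterate_degree T.f n = 1 + n"
        using T.degree_before_return[of n] nf \<alpha>\<^sub>2 by simp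
    next
      fix k n
      assume "periodic_map_of k (moebius 0 b0 1 c0)" "\<forall>n. (\<Sum>i\<le>n. \<alpha>\<^sub>1 ^ (i * k)) \<noteq> 0" "k \<le> n"
      then show "iterate_degree T.f n = k"
        using T.degree_saturates[of k n] nf \<alpha>\<^sub>2 by blast
    next
      fix k n
      assume "periodic_map_of k (moebius 0 b0 1 c0)" "(\<Sum>i\<le>n. \<alpha>\<^sub>1 ^ (i * k)) = 0"
      then show "seq_period ((n + 1) * k) (iterate_degree T.f)"
        using T.seq_period_degree[of k n] nf by blast
    next
      fix k n
      assume "periodic_map_of k (moebius 0 b0 1 c0)" "(\<Sum>i\<le>n. \<alpha>\<^sub>1 ^ (i * k)) = 0"
        "\<forall>m<n. (\<Sum>i\<le>m. \<alpha>\<^sub>1 ^ (i * k)) \<noteq> 0"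
      then show "periodic_seq_of ((n + 1) * k) (iterate_degree T.f)"
        using T.periodic_seq_of_degree[of k n] nf \<alpha>\<^sub>2 by blast
    qed
  next
    assume \<alpha>\<^sub>2: "\<alpha>\<^sub>2 = 0"
    show "\<exists>\<phi> a0 a1 b0 c0. affine_change \<phi> \<and> a1 \<noteq> 0 \<and> b0 \<noteq> 0 \<and>
          conjugate_by \<phi> f (fractional_map (a0, a1, 0) (b0, 0, 0) (c0, 0, 1))"
      unfolding f' using normal_form_exists[OF \<gamma>\<^sub>2 nondeg, of 1 0] \<alpha>\<^sub>2 by simp
    fix \<phi> a0 a1 b0 c0
    assume "affine_change \<phi>" "b0 \<noteq> 0" "conjugate_by \<phi> f (fractional_map (a0, a1, 0) (b0, 0, 0) (c0, 0, 1))"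
    note nf = normal[OF this]
    show "let h = moebius 0 b0 1 c0 in
             (\<not> periodic_map h \<longrightarrow> (\<forall>n\<ge>1. d n = 2)) \<and>
             (\<forall>k. periodic_map_of k h \<longrightarrow> periodic_seq_of k d)"
      unfolding Let_def Tf
    proof (intro conjI impI allI)
      fix n :: nat
      assume "\<not> periodic_map (moebius 0 b0 1 c0)" "1 \<le> n"
      then show "iterate_degree T.f n = 2"
        using T.degree_before_return[of n] nf \<alpha>\<^sub>2 by simp
    next
      fix k
      assume "periodic_map_of k (moebius 0 b0 1 c0)"
      then show "periodic_seq_of k (iterate_degree T.f)"
        using T.periodic_seq_of_degree_product[of k] nf \<alpha>\<^sub>2 by blast
    qed
  qed
qed

end
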